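(* Let $f:\mathbb{R}^d\to\mathbb{R}$ be convex and differentiable, $\psi:\mathbb{R}^d\to\mathbb{R}\cup\{+\infty\}$ convex, $P=f+\psi$, and let $x^*$ be a minimizer of $P$. Let $x^0\in\mathbb{R}^d$ and let $\mathbf{W}$ be a projection matrix such that $\psi(x)=\psi'(x)$ for $x\in x^0+\mathrm{Range}(\mathbf{W})$ and $\psi(x)=+\infty$ otherwise, for some convex $\psi'$. Let $f$ be $\mathbf{M}$-smooth on $\mathbb{R}^d$ and $\mu$-strongly convex over $x^0+\mathrm{Range}(\mathbf{W})$, $\mu>0$. Denote $L:=\lambda_{\max}(\mathbf{M}^{1/2}\mathbf{W}\mathbf{M}^{1/2})$ and let $\mathcal{L}'>0$ be such that along the iterates of ASVRCD, for all $k$, $$\mathbb{E}\big[\|g^k-\nabla f(x^k)\|_{\mathbf{W}}^2\big]\le 2\mathcal{L}'D_f(w^k,x^k).$$ Let $$\Psi^k:=\|z^k-x^*\|^2+\frac{2\gamma\beta}{\theta_1}\left[P(y^k)-P(x^* )\right]+\frac{(2\theta_2+\theta_1)\gamma\beta}{\theta_1\rho}\left[P(w^k)-P(x^* )\right]$$ and choose $$\eta=\tfrac14\max\{\mathcal{L}',L\}^{-1},\quad \theta_2=\frac{\mathcal{L}'}{2\max\{L,\mathcal{L}'\}},\quad \gamma=\frac1{\max\{2\mu,4\theta_1/\eta\}},\quad \beta=1-\gamma\mu,\quad \theta_1=\min\left\{\tfrac12,\sqrt{\eta\mu\max\left\{\tfrac12,\tfrac{\theta_2}{\rho}\right\}}\right\}.$$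 Then for every $k\ge0$, $$\mathbb{E}\left[\Psi^{k+1}\right]\le\left[1-\frac14\min\left\{\rho,\sqrt{\frac{\mu}{2\max\{L,\mathcal{L}'/\rho\}}}\right\}\right]\Psi^k,$$ where the expectation is conditional on the state $(x^k,y^k,z^k,w^k)$ of the algorithm. As a consequence, the iteration complexity of ASVRCD is $$\mathcal{O}\left(\left(\frac1\rho+\sqrt{\frac L\mu}+\sqrt{\frac{\mathcal{L}'}{\rho\mu}}\right)\log\frac1\epsilon\right).$$
   Context: Notation: $\|x\|_{\mathbf{A}}^2=\langle\mathbf{A}x,x\rangle$; $e_i$ is the $i$-th standard basis vector; $D_f(x,y)=f(x)-f(y)-\langle\nabla f(y),x-y\rangle$. Projection matrix means symmetric idempotent matrix; $\mathbf{M}$ is symmetric positive semidefinite. $\mathbf{M}$-smooth: $f(x)\le f(y)+\langle\nabla f(y),x-y\rangle+\frac12\|x-y\|_{\mathbf{M}}^2$ for all $x,y\in\mathbb{R}^d$. $\mu$-strongly convex over $x^0+\mathrm{Range}(\mathbf{W})$: $f(x)\ge f(y)+\langle\nabla f(y),x-y\rangle+\frac\mu2\|x-y\|^2$ for all $x,y\in x^0+\mathrm{Range}(\mathbf{W})$. $\mathrm{prox}_{\eta\psi}(x)=\arg\min_y\{\eta\psi(y)+\frac12\|y-x\|^2\}$ is assumed well defined (e.g. $\psi$ proper, closed, convex). ASVRCD (parameters $0<\theta_1,\theta_2<1$, $\eta,\beta,\gamma>0$, $\rho\in(0,1)$, and a distribution of a random set $S\subseteq\{1,\dots,d\}$ with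 $p_i=\mathbb{P}(i\in S)>0$): start with $w^0=y^0=z^0=x^0$. For $k=0,1,2,\dots$: $x^k=\theta_1z^k+\theta_2w^k+(1-\theta_1-\theta_2)y^k$; sample a fresh independent copy of $S$; $g^k=\nabla f(w^k)+\sum_{i\in S}\frac1{p_i}(\nabla_if(x^k)-\nabla_if(w^k))e_i$; $y^{k+1}=\mathrm{prox}_{\eta\psi}(x^k-\eta g^k)$; $z^{k+1}=\beta z^k+(1-\beta)x^k+\frac\gamma\eta(y^{k+1}-x^k)$; $w^{k+1}=y^k$ with probability $\rho$ and $w^{k+1}=w^k$ with probability $1-\rho$ (independently). In the bound defining $\mathcal{L}'$ the expectation is over the sampling of $S$ at iteration $k$. "Iteration complexity $\mathcal{O}(K\log\frac1\epsilon)$" means: there is a universal constant $c$ such that for every $\epsilon\in(0,1)$ and every $k\ge cK\log\frac1\epsilon$ one has $\mathbb{E}[\Psi^k]\le\epsilon\Psi^0$. *)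

theory Defs
  imports "HOL-Probability.Probability"
begin

section \<open>Linear algebra\<close>

definition wnorm_sq :: "real^'d^'d \<Rightarrow> real^'d \<Rightarrow> real" where
  "wnorm_sq A x = (A *v x) \<bullet> x"

definition psd :: "real^'d^'d \<Rightarrow> bool" where
  "psd A \<longleftrightarrow> transpose A = A \<and> (\<forall>x. 0 \<le> (A *v x) \<bullet> x)"

text \<open>For positive semidefinite \<open>A\<close> the positive semidefinite square root exists and is unique,
  so the choice operator picks \<open>A\<^sup>1\<^sup>/\<^sup>2\<close>.\<close>

definition psd_sqrt :: "real^'d^'d \<Rightarrow> real^'d^'d" where
  "psd_sqrt A = (SOME B. psd B \<and> B ** B = A)"

text \<open>Only used for symmetric \<open>A\<close>: the set of real eigenvalues is then nonempty; it is finite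
  for every \<open>A\<close>.\<close>

definition lambda_max :: "real^'d^'d \<Rightarrow> real" where
  "lambda_max A = Max {l. \<exists>v. v \<noteq> 0 \<and> A *v v = l *\<^sub>R v}"

definition projection_matrix :: "real^'d^'d \<Rightarrow> bool" where
  "projection_matrix W \<longleftrightarrow> transpose W = W \<and> W ** W = W"

definition affine_range :: "real^'d \<Rightarrow> real^'d^'d \<Rightarrow> (real^'d) set" where
  "affine_range x0 W = (\<lambda>v. x0 + v) ` range ((*v) W)"


section \<open>Smoothness and convexity\<close>

definition grad :: "(real^'d \<Rightarrow> real) \<Rightarrow> real^'d \<Rightarrow> real^'d" where
  "grad f x = (THE D. GDERIV f x :> D)"

definition bregman :: "(real^'d \<Rightarrow> real) \<Rightarrow> real^'d \<Rightarrow> real^'d \<Rightarrow> real" where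
  "bregman f x y = f x - f y - grad f y \<bullet> (x - y)"

definition matrix_smooth :: "(real^'d \<Rightarrow> real) \<Rightarrow> real^'d^'d \<Rightarrow> bool" where
  "matrix_smooth f M \<longleftrightarrow>
     (\<forall>x y. f x \<le> f y + grad f y \<bullet> (x - y) + 1/2 * wnorm_sq M (x - y))"

definition strongly_convex_over :: "(real^'d) set \<Rightarrow> real \<Rightarrow> (real^'d \<Rightarrow> real) \<Rightarrow> bool" where
  "strongly_convex_over A \<mu> f \<longleftrightarrow>
     (\<forall>x\<in>A. \<forall>y\<in>A. f x \<ge> f y + grad f y \<bullet> (x - y) + \<mu>/2 * (norm (x - y))\<^sup>2)"

text \<open>Convex functions with values in \<open>\<real> \<union> {+\<infinity>}\<close>. In \<^typ>\<open>ereal\<close>, \<open>0 * \<infinity> = 0\<close>, so the end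
  points \<open>t = 0\<close> and \<open>t = 1\<close> are harmless.\<close>

definition ext_convex :: "(real^'d \<Rightarrow> ereal) \<Rightarrow> bool" where
  "ext_convex \<psi> \<longleftrightarrow> (\<forall>x. \<psi> x \<noteq> -\<infinity>) \<and>
     (\<forall>x y. \<forall>t\<in>{0..1}. \<psi> ((1 - t) *\<^sub>R x + t *\<^sub>R y) \<le> ereal (1 - t) * \<psi> x + ereal t * \<psi> y)"

definition objective :: "(real^'d \<Rightarrow> real) \<Rightarrow> (real^'d \<Rightarrow> ereal) \<Rightarrow> real^'d \<Rightarrow> ereal" where
  "objective f \<psi> x = ereal (f x) + \<psi> x"

definition prox_objective :: "real \<Rightarrow> (real^'d \<Rightarrow> ereal) \<Rightarrow> real^'d \<Rightarrow> real^'d \<Rightarrow> ereal" where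
  "prox_objective \<eta> \<psi> x y = ereal \<eta> * \<psi> y + ereal (1/2 * (norm (y - x))\<^sup>2)"

definition prox :: "real \<Rightarrow> (real^'d \<Rightarrow> ereal) \<Rightarrow> real^'d \<Rightarrow> real^'d" where
  "prox \<eta> \<psi> x = arg_min (prox_objective \<eta> \<psi> x) (\<lambda>_. True)"

definition prox_well_defined :: "real \<Rightarrow> (real^'d \<Rightarrow> ereal) \<Rightarrow> bool" where
  "prox_well_defined \<eta> \<psi> \<longleftrightarrow> (\<forall>x. \<exists>!y. is_arg_min (prox_objective \<eta> \<psi> x) (\<lambda>_. True) y)"


section \<open>ASVRCD\<close>

text \<open>A state is the triple \<open>(y, z, w)\<close>; the point \<open>x\<close> is a function of it. The parameter \<open>D\<close> is the
  law of the random coordinate set \<open>S\<close>; as there are only finitely many coordinate sets, a \<open>pmf\<close>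
  covers every distribution, and the law of the \<open>k\<close>-th state has finite support.\<close>

type_synonym 'd asvrcd_state = "(real^'d) \<times> (real^'d) \<times> (real^'d)"

definition x_point :: "real \<Rightarrow> real \<Rightarrow> 'd::finite asvrcd_state \<Rightarrow> real^'d" where
  "x_point \<theta>1 \<theta>2 = (\<lambda>(y, z, w). \<theta>1 *\<^sub>R z + \<theta>2 *\<^sub>R w + (1 - \<theta>1 - \<theta>2) *\<^sub>R y)"

definition incl_prob :: "'d::finite set pmf \<Rightarrow> 'd \<Rightarrow> real" where
  "incl_prob D i = measure_pmf.prob D {S. i \<in> S}"

definition grad_estimator ::
    "(real^'d \<Rightarrow> real) \<Rightarrow> 'd::finite set pmf \<Rightarrow> real^'d \<Rightarrow> real^'d \<Rightarrow> 'd set \<Rightarrow> real^'d" where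
  "grad_estimator f D x w S =
     grad f w + (\<Sum>i\<in>S. (1 / incl_prob D i * (grad f x $ i - grad f w $ i)) *\<^sub>R axis i 1)"

definition asvrcd_step ::
    "(real^'d \<Rightarrow> real) \<Rightarrow> (real^'d \<Rightarrow> ereal) \<Rightarrow> 'd::finite set pmf \<Rightarrow>
     real \<Rightarrow> real \<Rightarrow> real \<Rightarrow> real \<Rightarrow> real \<Rightarrow> real \<Rightarrow> 'd asvrcd_state \<Rightarrow> 'd asvrcd_state pmf" where
  "asvrcd_step f \<psi> D \<theta>1 \<theta>2 \<eta> \<beta> \<gamma> \<rho> = (\<lambda>(y, z, w).
     let x = x_point \<theta>1 \<theta>2 (y, z, w) in
     bind_pmf D (\<lambda>S. bind_pmf (bernoulli_pmf \<rho>) (\<lambda>b.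
       let g = grad_estimator f D x w S;
           y' = prox \<eta> \<psi> (x - \<eta> *\<^sub>R g);
           z' = \<beta> *\<^sub>R z + (1 - \<beta>) *\<^sub>R x + (\<gamma> / \<eta>) *\<^sub>R (y' - x);
           w' = (if b then y else w)
       in return_pmf (y', z', w'))))"

text \<open>The law of \<open>(y\<^sup>k, z\<^sup>k, w\<^sup>k)\<close>.\<close>

primrec asvrcd ::
    "(real^'d \<Rightarrow> real) \<Rightarrow> (real^'d \<Rightarrow> ereal) \<Rightarrow> 'd::finite set pmf \<Rightarrow>
     real \<Rightarrow> real \<Rightarrow> real \<Rightarrow> real \<Rightarrow> real \<Rightarrow> real \<Rightarrow> real^'d \<Rightarrow> nat \<Rightarrow> 'd asvrcd_state pmf" where
  "asvrcd f \<psi> D \<theta>1 \<theta>2 \<eta> \<beta> \<gamma> \<rho> x0 0 = return_pmf (x0, x0, x0)"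
| "asvrcd f \<psi> D \<theta>1 \<theta>2 \<eta> \<beta> \<gamma> \<rho> x0 (Suc k) =
     bind_pmf (asvrcd f \<psi> D \<theta>1 \<theta>2 \<eta> \<beta> \<gamma> \<rho> x0 k) (asvrcd_step f \<psi> D \<theta>1 \<theta>2 \<eta> \<beta> \<gamma> \<rho>)"

text \<open>The potential is \<open>+\<infinity>\<close> if \<open>\<psi>\<close> is \<open>+\<infinity>\<close> at \<open>y\<close> or \<open>w\<close>, which can happen if \<open>\<psi>(x\<^sup>0) = +\<infinity>\<close>.\<close>

definition potential ::
    "(real^'d \<Rightarrow> real) \<Rightarrow> (real^'d \<Rightarrow> ereal) \<Rightarrow> real \<Rightarrow> real \<Rightarrow> real \<Rightarrow> real \<Rightarrow> real \<Rightarrow>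
     real^'d \<Rightarrow> 'd::finite asvrcd_state \<Rightarrow> ereal" where
  "potential f \<psi> \<theta>1 \<theta>2 \<beta> \<gamma> \<rho> xstar = (\<lambda>(y, z, w).
     ereal ((norm (z - xstar))\<^sup>2)
     + ereal (2 * \<gamma> * \<beta> / \<theta>1) * (objective f \<psi> y - objective f \<psi> xstar)
     + ereal ((2 * \<theta>2 + \<theta>1) * \<gamma> * \<beta> / (\<theta>1 * \<rho>)) * (objective f \<psi> w - objective f \<psi> xstar))"

text \<open>Expectation of a nonnegative extended real random variable. The conversion to
  \<^typ>\<open>ennreal\<close> truncates negative values; the potential has none when \<open>xstar\<close> minimizes the
  objective and its coefficients are nonnegative.\<close>

definition ext_expectation :: "'a pmf \<Rightarrow> ('a \<Rightarrow> ereal) \<Rightarrow> ereal" where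
  "ext_expectation p X = enn2ereal (\<integral>\<^sup>+ s. e2ennreal (X s) \<partial>measure_pmf p)"

text \<open>Iteration complexity \<open>O(K log (1/\<epsilon>))\<close> with constant \<open>c\<close> for the sequence \<open>E\<close> of expected
  potentials started at \<open>E0\<close>. The constant has to be universal: independent of all problem data
  and of the dimension. As the dimension is a type, \<open>\<exists>c\<close> inside a theorem would
  only yield a constant for each dimension; \<open>c\<close> is therefore a parameter, to be instantiated
  with a numeral.\<close>

definition iteration_complexity :: "real \<Rightarrow> real \<Rightarrow> (nat \<Rightarrow> ereal) \<Rightarrow> ereal \<Rightarrow> bool" where
  "iteration_complexity c K E E0 \<longleftrightarrow>
     (\<forall>\<epsilon>\<in>{0<..<1}. \<forall>k. real k \<ge> c * K * ln (1 / \<epsilon>) \<longrightarrow> E k \<le> ereal \<epsilon> * E0)"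

end

theory Submission
  imports Defs
begin

text \<open>
  The proof is a Lyapunov argument: one step of the method shrinks the potential in conditional
  expectation by the factor \<open>1 - rate\<close>, and the iteration complexity follows by iterating.

  All iterates stay in the affine space \<open>x0 + Range W\<close>, where \<open>f\<close> is \<open>L\<close>-smooth and
  \<open>\<mu>\<close>-strongly convex for the Euclidean norm. That \<open>L = lambda_max (M\<^sup>1\<^sup>/\<^sup>2 W M\<^sup>1\<^sup>/\<^sup>2)\<close> is a
  smoothness constant there (\<open>wnorm_sq_le_on_range\<close>) rests on the spectral theorem for symmetric
  matrices (\<open>selfadjoint_orthonormal_eigenbasis\<close>), which also provides the square root of \<open>M\<close>.

  For a fixed outcome of the sampling, the optimality condition of the proximal step is compared
  with the three points \<open>xstar\<close>, \<open>w\<close> and \<open>y\<close>. Because \<open>x\<close> is a convex combination of \<open>z\<close>, \<open>w\<close> and \<open>y\<close>,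
  the suitably weighted sum of these comparisons is precisely what appears when
  the squared distance from the new \<open>z\<close> to \<open>xstar\<close> is expanded (\<open>accelerated_step_inequality\<close>). In
  expectation the estimator becomes the gradient, the strong convexity term at \<open>xstar\<close> pays for
  moving \<open>z\<close> towards \<open>x\<close>, and the Bregman distance from the comparison with \<open>w\<close> pays for the variance
  (\<open>expected_step_inequality\<close>). This is where \<open>\<theta>2\<close> is balanced against \<open>L'\<close>, and \<open>\<beta>\<close> against \<open>\<mu>\<close>.

  The three parts of the potential then contract by \<open>\<beta>\<close>, \<open>1 - \<theta>1 / 2\<close> and
  \<open>1 - \<rho> \<theta>1 / (2 \<theta>2 + \<theta>1)\<close>. With \<open>N = max L (L' / \<rho>)\<close>, the choice of \<open>\<theta>1\<close> makes each of these at most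
  \<open>1 - rate\<close> where \<open>rate\<close> is a quarter of the minimum of \<open>\<rho>\<close> and \<open>sqrt (\<mu> / (2 N))\<close>
  (\<open>potential_weights_contract\<close>).

  The values of \<open>\<psi>\<close> may be infinite. A minimizer and all proximal points have finite objective, so the
  only infinite potentials arise from the initial point, and for these the claims are
  trivial.
\<close>

section \<open>Symmetric matrices and smoothness along a subspace\<close>

lemma dot_matrix_vector_symmetric:
  fixes A :: "real^'n^'n"
  assumes "transpose A = A"
  shows "(A *v x) \<bullet> y = x \<bullet> (A *v y)"
  by (metis assms dot_lmul_matrix transpose_matrix_vector)

text \<open>The quadratic form \<open>x \<bullet> T x\<close> attains its maximum \<open>l\<close> over the unit sphere of \<open>S\<close> at some \<open>v\<close>.
  Then \<open>l * (x \<bullet> x) - x \<bullet> T x\<close> is nonnegative on \<open>S\<close> and vanishes at \<open>v\<close>, so its first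
  variation at \<open>v\<close>, in the direction \<open>l *\<^sub>R v - T v\<close> of \<open>S\<close>, vanishes as well.\<close>

lemma selfadjoint_imp_eigenvector:
  fixes T :: "'a::euclidean_space \<Rightarrow> 'a"
  assumes lin: "linear T" and sym: "\<And>x y. T x \<bullet> y = x \<bullet> T y"
    and S: "subspace S" and inv: "\<And>x. x \<in> S \<Longrightarrow> T x \<in> S" and nz: "S \<noteq> {0}"
  obtains v l where "v \<in> S" "norm v = 1" "T v = l *\<^sub>R v"
proof -
  let ?K = "sphere 0 1 \<inter> S"
  obtain u where u: "u \<in> S" "u \<noteq> 0" using nz S subspace_0 by blast
  then have "(1 / norm u) *\<^sub>R u \<in> ?K" using S by (simp add: subspace_scale)
  then have ne: "?K \<noteq> {}" by blast
  have comp: "compact ?K"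
    by (simp add: S closed_subspace compact_Int_closed)
  have cont: "continuous_on ?K (\<lambda>x. x \<bullet> T x)"
    by (intro continuous_intros linear_continuous_on linear_conv_bounded_linear[THEN iffD1] lin)
  obtain v where v: "v \<in> ?K" and vmax: "\<And>x. x \<in> ?K \<Longrightarrow> x \<bullet> T x \<le> v \<bullet> T v"
    using continuous_attains_sup[OF comp ne cont] by blast
  define l where "l = v \<bullet> T v"
  have vv: "v \<bullet> v = 1" and vS: "v \<in> S" and nv: "norm v = 1"
    using v by (auto simp: norm_eq_1)
  have bound: "x \<bullet> T x \<le> l * (x \<bullet> x)" if "x \<in> S" for x
  proof (cases "x = 0")
    case False
    let ?y = "(1 / norm x) *\<^sub>R x"
    have "?y \<in> ?K" using that S False by (simp add: subspace_scale)
    from vmax[OF this] have "(x \<bullet> T x) / (norm x)\<^sup>2 \<le> l"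
      by (simp add: linear_scale[OF lin] l_def power2_eq_square)
    with False show ?thesis
      by (simp add: divide_le_eq power2_norm_eq_inner)
  qed (simp add: linear_0[OF lin])
  (* Perturb v by t h: the first-order term is 2 t (h \<bullet> h), so h must vanish. *)
  define h where "h = l *\<^sub>R v - T v"
  have hS: "h \<in> S" unfolding h_def using vS inv S by (simp add: subspace_diff subspace_scale)
  define q where "q = l * (h \<bullet> h) - h \<bullet> T h"
  have quad: "0 \<le> 2 * t * (h \<bullet> h) + t\<^sup>2 * q" for t
  proof -
    have "v + t *\<^sub>R h \<in> S" using vS hS S by (simp add: subspace_add subspace_scale)
    from bound[OF this]
    have "0 \<le> l * ((v + t *\<^sub>R h) \<bullet> (v + t *\<^sub>R h)) - (v + t *\<^sub>R h) \<bullet> T (v + t *\<^sub>R h)"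
      by simp
    also have "\<dots> = 2 * t * (l * (v \<bullet> h) - T v \<bullet> h) + t\<^sup>2 * q"
      using sym[of v h] vv
      by (simp add: linear_add[OF lin] linear_scale[OF lin] inner_add_left inner_add_right
          q_def l_def inner_commute algebra_simps power2_eq_square)
    also have "l * (v \<bullet> h) - T v \<bullet> h = h \<bullet> h"
      by (simp add: h_def inner_diff_left)
    finally show ?thesis .
  qed
  have "h \<bullet> h = 0"
  proof (rule ccontr)
    assume "h \<bullet> h \<noteq> 0"
    then have pos: "h \<bullet> h > 0" by simp
    (* A negative t so small that the quadratic term cannot compensate the linear one. *)
    define t where "t = - (h \<bullet> h) / (\<bar>q\<bar> + 1)"
    have "t < 0" using pos by (simp add: t_def divide_neg_pos)
    have "0 \<le> t * (2 * (h \<bullet> h) + t * q)" using quad[of t] by (simp add: algebra_simps power2_eq_square)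
    then have "2 * (h \<bullet> h) + t * q \<le> 0" using \<open>t < 0\<close> by (simp add: zero_le_mult_iff)
    moreover have "\<bar>t * q\<bar> \<le> h \<bullet> h"
    proof -
      have "\<bar>t * q\<bar> = (h \<bullet> h) * (\<bar>q\<bar> / (\<bar>q\<bar> + 1))" using pos by (simp add: t_def abs_mult)
      also have "\<dots> \<le> (h \<bullet> h) * 1" using pos by (intro mult_left_mono) auto
      finally show ?thesis by simp
    qed
    ultimately show False using pos by linarith
  qed
  then have "T v = l *\<^sub>R v" by (simp add: h_def)
  then show thesis using that vS nv by blast
qed

text \<open>The spectral theorem for a self-adjoint map on an invariant subspace, by induction on the
  dimension: split off one eigenvector; its orthogonal complement in \<open>S\<close> is again invariant.\<close>

lemma selfadjoint_orthonormal_eigenbasis: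
  fixes T :: "'a::euclidean_space \<Rightarrow> 'a"
  assumes lin: "linear T" and sym: "\<And>x y. T x \<bullet> y = x \<bullet> T y"
    and "subspace S" and "\<And>x. x \<in> S \<Longrightarrow> T x \<in> S"
  shows "\<exists>B l. finite B \<and> (\<forall>b\<in>B. norm b = 1 \<and> T b = l b *\<^sub>R b) \<and> pairwise orthogonal B
           \<and> B \<subseteq> S \<and> (\<forall>x\<in>S. x = (\<Sum>b\<in>B. (x \<bullet> b) *\<^sub>R b))"
  using assms(3,4)
proof (induction "dim S" arbitrary: S rule: less_induct)
  case less
  show ?case
  proof (cases "S = {0}")
    case True
    then show ?thesis by (intro exI[of _ "{}"]) auto
  next
    case False
    obtain v m where v: "v \<in> S" "norm v = 1" "T v = m *\<^sub>R v"
      using selfadjoint_imp_eigenvector[OF lin sym less.prems False] by blast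
    have vv: "v \<bullet> v = 1" using v(2) by (simp add: norm_eq_1)
    define S' where "S' = S \<inter> {x. x \<bullet> v = 0}"
    have sub: "subspace S'" unfolding S'_def
      by (intro subspace_inter less.prems) (auto simp: subspace_def inner_add_left)
    have "v \<notin> S'" using vv by (simp add: S'_def)
    then have "S' \<subset> S" using v(1) unfolding S'_def by blast
    then have "dim S' < dim S"
      using less.prems(1) sub by (metis dim_psubset span_eq_iff)
    moreover have "T x \<in> S'" if "x \<in> S'" for x
      using that less.prems(2) by (auto simp: S'_def sym v(3))
    ultimately obtain B l where B: "finite B" "\<forall>b\<in>B. norm b = 1 \<and> T b = l b *\<^sub>R b"
      "pairwise orthogonal B" "B \<subseteq> S'" "\<forall>x\<in>S'. x = (\<Sum>b\<in>B. (x \<bullet> b) *\<^sub>R b)"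
      using less.hyps[of S'] sub by blast
    have vB: "v \<notin> B" using \<open>v \<notin> S'\<close> B(4) by blast
    have ob: "v \<bullet> b = 0" if "b \<in> B" for b
      using that B(4) by (auto simp: S'_def inner_commute)
    have exp: "x = (\<Sum>b\<in>insert v B. (x \<bullet> b) *\<^sub>R b)" if "x \<in> S" for x
    proof -
      have "x - (x \<bullet> v) *\<^sub>R v \<in> S'"
        using that v less.prems(1) vv by (simp add: S'_def subspace_diff subspace_scale inner_diff_left)
      then have "x - (x \<bullet> v) *\<^sub>R v = (\<Sum>b\<in>B. ((x - (x \<bullet> v) *\<^sub>R v) \<bullet> b) *\<^sub>R b)"
        using B(5) by blast
      also have "\<dots> = (\<Sum>b\<in>B. (x \<bullet> b) *\<^sub>R b)"
        by (intro sum.cong) (auto simp: inner_diff_left ob)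
      finally show ?thesis using vB B(1) by (simp add: algebra_simps)
    qed
    show ?thesis
    proof (intro exI[of _ "insert v B"] exI[of _ "l(v := m)"] conjI)
      show "pairwise orthogonal (insert v B)"
        using B(3) ob vB by (auto simp: pairwise_insert orthogonal_def inner_commute)
      show "insert v B \<subseteq> S" using v B(4) by (auto simp: S'_def)
    qed (use B v vB exp in auto)
  qed
qed

lemma symmetric_matrix_eigenbasis:
  fixes A :: "real^'n^'n"
  assumes "transpose A = A"
  obtains B l where "finite B" "\<And>b. b \<in> B \<Longrightarrow> A *v b = l b *\<^sub>R b"
    "\<And>a b. a \<in> B \<Longrightarrow> b \<in> B \<Longrightarrow> a \<bullet> b = (if a = b then 1 else 0)"
    "\<And>x. (\<Sum>b\<in>B. (x \<bullet> b) *\<^sub>R b) = x"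
proof -
  obtain B l where B: "finite B" "\<forall>b\<in>B. norm b = 1 \<and> A *v b = l b *\<^sub>R b"
      "pairwise orthogonal B" "\<forall>x. x = (\<Sum>b\<in>B. (x \<bullet> b) *\<^sub>R b)"
    using selfadjoint_orthonormal_eigenbasis[of "(*v) A" UNIV] dot_matrix_vector_symmetric[OF assms]
    by (auto simp: matrix_vector_mul_linear)
  show thesis
  proof (rule that[of B l])
    show "a \<bullet> b = (if a = b then 1 else 0)" if "a \<in> B" "b \<in> B" for a b
      using that B(2,3) by (auto simp: pairwise_def orthogonal_def norm_eq_1)
    show "(\<Sum>b\<in>B. (x \<bullet> b) *\<^sub>R b) = x" for x using B(4) by metis
  qed (use B in auto)
qed

text \<open>Taking square roots of the eigenvalues in an orthonormal eigenbasis. The lemma justifies the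
  choice in the definition of \<open>psd_sqrt\<close>.\<close>

lemma psd_sqrt_exists:
  assumes "psd A"
  shows "\<exists>R. psd R \<and> R ** R = A"
proof -
  have symA: "transpose A = A" and pos: "\<And>x. 0 \<le> (A *v x) \<bullet> x"
    using assms by (auto simp: psd_def)
  obtain B l where B: "finite B" and eig: "\<And>b. b \<in> B \<Longrightarrow> A *v b = l b *\<^sub>R b"
    and on: "\<And>a b. a \<in> B \<Longrightarrow> b \<in> B \<Longrightarrow> a \<bullet> b = (if a = b then 1 else 0)"
    and ex: "\<And>x. (\<Sum>b\<in>B. (x \<bullet> b) *\<^sub>R b) = x"
    by (rule symmetric_matrix_eigenbasis[OF symA]) blast
  have l0: "0 \<le> l b" if "b \<in> B" for b
    using pos[of b] eig[OF that] on[OF that that] by simp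
  define T where "T x = (\<Sum>b\<in>B. (sqrt (l b) * (x \<bullet> b)) *\<^sub>R b)" for x
  have lin: "linear T" unfolding T_def
    by (intro linearI) (simp_all add: inner_add_left algebra_simps sum.distrib scaleR_sum_right)
  have Tb: "T x \<bullet> b = sqrt (l b) * (x \<bullet> b)" if "b \<in> B" for x b
  proof -
    have "T x \<bullet> b = (\<Sum>a\<in>B. if a = b then sqrt (l a) * (x \<bullet> a) else 0)"
      unfolding T_def inner_sum_left using on that by (intro sum.cong) auto
    then show ?thesis using that B by simp
  qed
  have TT: "T (T x) = A *v x" for x
  proof -
    have "T (T x) = (\<Sum>b\<in>B. (sqrt (l b) * (sqrt (l b) * (x \<bullet> b))) *\<^sub>R b)"
      by (subst T_def) (intro sum.cong refl, simp add: Tb)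
    also have "\<dots> = (\<Sum>b\<in>B. (x \<bullet> b) *\<^sub>R (A *v b))"
    proof (intro sum.cong refl)
      fix b assume "b \<in> B"
      then have "sqrt (l b) * sqrt (l b) = l b" using l0 by simp
      then have "sqrt (l b) * (sqrt (l b) * (x \<bullet> b)) = l b * (x \<bullet> b)"
        by (metis mult.assoc)
      then show "(sqrt (l b) * (sqrt (l b) * (x \<bullet> b))) *\<^sub>R b = (x \<bullet> b) *\<^sub>R (A *v b)"
        using eig[OF \<open>b \<in> B\<close>] by (simp add: mult.commute)
    qed
    also have "\<dots> = A *v (\<Sum>b\<in>B. (x \<bullet> b) *\<^sub>R b)"
      by (simp add: linear_sum[OF matrix_vector_mul_linear] matrix_vector_mult_scaleR)
    finally show ?thesis by (simp add: ex)
  qed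
  have inner_T: "T x \<bullet> y = (\<Sum>b\<in>B. sqrt (l b) * ((x \<bullet> b) * (y \<bullet> b)))" for x y
    unfolding T_def inner_sum_left by (intro sum.cong refl) (simp add: inner_commute[of _ y] mult.assoc)
  have mT: "matrix T *v x = T x" for x using lin by simp
  have "transpose (matrix T) = matrix T"
  proof -
    have "(transpose (matrix T) *v x) \<bullet> y = (matrix T *v x) \<bullet> y" for x y
    proof -
      have "(transpose (matrix T) *v x) \<bullet> y = x \<bullet> (matrix T *v y)"
        by (metis dot_lmul_matrix transpose_matrix_vector)
      also have "\<dots> = T y \<bullet> x" by (simp only: mT inner_commute)
      also have "\<dots> = T x \<bullet> y" by (simp add: inner_T mult.commute)
      finally show ?thesis by (simp only: mT)
    qed
    then show ?thesis by (metis matrix_eq vector_eq_rdot)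
  qed
  moreover have "0 \<le> (matrix T *v x) \<bullet> x" for x
    unfolding mT inner_T using l0 by (intro sum_nonneg) auto
  moreover have "matrix T ** matrix T = A"
    by (simp add: matrix_eq mT TT flip: matrix_vector_mul_assoc)
  ultimately show ?thesis unfolding psd_def by blast
qed

text \<open>Expanding in an orthonormal eigenbasis turns the quadratic form into a weighted sum of squares.
  Every eigenvalue is one of the finitely many weights of the basis, so that the maximum in the
  definition of \<open>lambda_max\<close> is attained and bounds them all.\<close>

lemma quadratic_form_le_lambda_max:
  fixes A :: "real^'n^'n"
  assumes symA: "transpose A = A"
  shows "(A *v x) \<bullet> x \<le> lambda_max A * (norm x)\<^sup>2"
proof -
  obtain B l where B: "finite B" and eig: "\<And>b. b \<in> B \<Longrightarrow> A *v b = l b *\<^sub>R b"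
    and on: "\<And>a b. a \<in> B \<Longrightarrow> b \<in> B \<Longrightarrow> a \<bullet> b = (if a = b then 1 else 0)"
    and ex: "\<And>x. (\<Sum>b\<in>B. (x \<bullet> b) *\<^sub>R b) = x"
    by (rule symmetric_matrix_eigenbasis[OF symA]) blast
  let ?E = "{l. \<exists>v. v \<noteq> 0 \<and> A *v v = l *\<^sub>R v}"
  have "?E \<subseteq> l ` B"
  proof
    fix m assume "m \<in> ?E"
    then obtain v where v: "v \<noteq> 0" "A *v v = m *\<^sub>R v" by blast
    have "\<exists>b\<in>B. v \<bullet> b \<noteq> 0"
    proof (rule ccontr)
      assume "\<not> ?thesis"
      then have "(\<Sum>b\<in>B. (v \<bullet> b) *\<^sub>R b) = 0" by (intro sum.neutral) auto
      with ex[of v] v(1) show False by simp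
    qed
    then obtain b where b: "b \<in> B" "v \<bullet> b \<noteq> 0" by blast
    have "m * (v \<bullet> b) = (A *v v) \<bullet> b" by (simp add: v)
    also have "\<dots> = l b * (v \<bullet> b)"
      by (simp add: dot_matrix_vector_symmetric[OF symA] eig[OF b(1)])
    finally show "m \<in> l ` B" using b by simp
  qed
  then have finE: "finite ?E" using B by (meson finite_imageI finite_subset)
  have le: "l b \<le> lambda_max A" if "b \<in> B" for b
  proof -
    have "b \<noteq> 0" using on[OF that that] by auto
    then show ?thesis unfolding lambda_max_def using finE eig[OF that] by (intro Max_ge) auto
  qed
  have form: "(\<Sum>b\<in>B. (x \<bullet> b)\<^sup>2) = (norm x)\<^sup>2"
  proof -
    have "(norm x)\<^sup>2 = (\<Sum>b\<in>B. (x \<bullet> b) *\<^sub>R b) \<bullet> x"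
      by (simp add: ex power2_norm_eq_inner)
    also have "\<dots> = (\<Sum>b\<in>B. (x \<bullet> b)\<^sup>2)"
      unfolding inner_sum_left by (intro sum.cong refl) (simp add: power2_eq_square inner_commute[of _ x])
    finally show ?thesis by simp
  qed
  have "(A *v x) \<bullet> x = (A *v (\<Sum>b\<in>B. (x \<bullet> b) *\<^sub>R b)) \<bullet> x" by (simp add: ex)
  also have "\<dots> = (\<Sum>b\<in>B. l b * (x \<bullet> b)\<^sup>2)"
    unfolding linear_sum[OF matrix_vector_mul_linear] inner_sum_left
    by (intro sum.cong refl)
       (simp add: matrix_vector_mult_scaleR eig power2_eq_square inner_commute)
  also have "\<dots> \<le> (\<Sum>b\<in>B. lambda_max A * (x \<bullet> b)\<^sup>2)"
    using le by (intro sum_mono mult_right_mono) auto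
  also have "\<dots> = lambda_max A * (norm x)\<^sup>2"
    by (simp add: form flip: sum_distrib_left)
  finally show ?thesis .
qed

text \<open>The constant \<open>L\<close> is the smoothness constant along the range of \<open>W\<close>: with \<open>R\<close> the square root of
  \<open>M\<close>, the matrices \<open>R W R = (W R)\<^sup>T (W R)\<close> and \<open>W M W = (W R) (W R)\<^sup>T\<close> have the same largest
  eigenvalue. The proof below gets the one bound from the other by the Cauchy-Schwarz inequality.\<close>

context
  fixes M W :: "real^'n^'n" and L :: real
  assumes M_psd: "psd M" and W_proj: "projection_matrix W"
    and L_eq: "L = lambda_max (psd_sqrt M ** W ** psd_sqrt M)"
begin

lemma psd_sqrt_M: "psd (psd_sqrt M)" "psd_sqrt M ** psd_sqrt M = M"
  unfolding psd_sqrt_def using someI_ex[OF psd_sqrt_exists[OF M_psd]] by auto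

lemma projection_form: "(W *v x) \<bullet> y = (W *v x) \<bullet> (W *v y)"
  using W_proj dot_matrix_vector_symmetric[of W "W *v x" y]
  by (simp add: projection_matrix_def matrix_vector_mul_assoc)

lemma projected_form_le: "(norm (W *v (psd_sqrt M *v u)))\<^sup>2 \<le> L * (norm u)\<^sup>2"
proof -
  let ?R = "psd_sqrt M"
  have R: "transpose ?R = ?R" using psd_sqrt_M by (simp add: psd_def)
  have W: "transpose W = W" using W_proj by (simp add: projection_matrix_def)
  have "((?R ** W ** ?R) *v u) \<bullet> u = (W *v (?R *v u)) \<bullet> (?R *v u)"
    by (simp add: dot_matrix_vector_symmetric[OF R] flip: matrix_vector_mul_assoc)
  also have "\<dots> = (norm (W *v (?R *v u)))\<^sup>2"
    by (subst projection_form) (simp add: power2_norm_eq_inner)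
  finally show ?thesis
    using quadratic_form_le_lambda_max[of "?R ** W ** ?R" u]
    by (simp add: L_eq matrix_transpose_mul R W matrix_mul_assoc)
qed

lemma lambda_max_nonneg: "0 \<le> L"
proof -
  have "0 \<le> L * (norm (axis i 1 :: real^'n))\<^sup>2" for i
    using projected_form_le by (meson order_trans zero_le_power2)
  then show ?thesis by simp
qed

lemma wnorm_sq_le_on_range:
  assumes "v \<in> range ((*v) W)"
  shows "wnorm_sq M v \<le> L * (norm v)\<^sup>2"
proof -
  let ?R = "psd_sqrt M"
  have R: "transpose ?R = ?R" using psd_sqrt_M by (simp add: psd_def)
  have W: "transpose W = W" using W_proj by (simp add: projection_matrix_def)
  have Wv: "W *v v = v"
    using assms W_proj by (auto simp: projection_matrix_def matrix_vector_mul_assoc)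
  let ?a = "norm (?R *v v)"
  have form: "wnorm_sq M v = ?a\<^sup>2"
  proof -
    have "wnorm_sq M v = (?R *v (?R *v v)) \<bullet> v"
      by (simp add: wnorm_sq_def psd_sqrt_M matrix_vector_mul_assoc)
    then show ?thesis by (simp add: dot_matrix_vector_symmetric[OF R] power2_norm_eq_inner)
  qed
  (* Put u = R v. Then |u|^2 = (W R u) \<bullet> v <= |W R u| |v| and |W R u|^2 <= L |u|^2. *)
  have "?a\<^sup>2 = (W *v (?R *v (?R *v v))) \<bullet> v"
    by (simp add: dot_matrix_vector_symmetric[OF R] dot_matrix_vector_symmetric[OF W] Wv
        power2_norm_eq_inner)
  also have "\<dots> \<le> norm (W *v (?R *v (?R *v v))) * norm v" by (rule norm_cauchy_schwarz)
  finally have "?a\<^sup>2 * ?a\<^sup>2 \<le> (norm (W *v (?R *v (?R *v v))) * norm v)\<^sup>2"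
    by (simp add: power2_eq_square mult_mono)
  also have "\<dots> \<le> (L * ?a\<^sup>2) * (norm v)\<^sup>2"
    unfolding power_mult_distrib by (intro mult_right_mono projected_form_le) auto
  finally have prod: "?a\<^sup>2 * ?a\<^sup>2 \<le> ?a\<^sup>2 * (L * (norm v)\<^sup>2)" by (simp add: algebra_simps)
  have "?a\<^sup>2 \<le> L * (norm v)\<^sup>2"
  proof (cases "?a = 0")
    case True
    then show ?thesis using lambda_max_nonneg by simp
  next
    case False
    then have "0 < ?a\<^sup>2" by simp
    with prod show ?thesis by (rule mult_left_le_imp_le)
  qed
  then show ?thesis by (simp add: form)
qed

end


section \<open>Proximal points and the gradient estimator\<close>

lemma prox_is_arg_min:
  assumes "prox_well_defined \<eta> \<psi>"
  shows "is_arg_min (prox_objective \<eta> \<psi> v) (\<lambda>_. True) (prox \<eta> \<psi> v)"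
proof -
  have "\<exists>y. is_arg_min (prox_objective \<eta> \<psi> v) (\<lambda>_. True) y"
    using assms by (auto simp: prox_well_defined_def)
  then show ?thesis unfolding prox_def arg_min_def by (rule someI_ex)
qed

text \<open>If the minimal value of the proximal objective were infinite, every point would be a minimizer,
  against uniqueness.\<close>

lemma prox_finite:
  assumes wd: "prox_well_defined \<eta> \<psi>" and eta: "\<eta> > 0"
  shows "\<psi> (prox \<eta> \<psi> v) \<noteq> \<infinity>"
proof
  let ?y = "prox \<eta> \<psi> v"
  assume inf: "\<psi> ?y = \<infinity>"
  have le: "prox_objective \<eta> \<psi> v ?y \<le> prox_objective \<eta> \<psi> v u" for u
    using prox_is_arg_min[OF wd, of v] by (simp add: is_arg_min_linorder)
  have "prox_objective \<eta> \<psi> v ?y = \<infinity>"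
    using eta inf by (simp add: prox_objective_def)
  then have all: "prox_objective \<eta> \<psi> v u = \<infinity>" for u using le[of u] by simp
  then have "is_arg_min (prox_objective \<eta> \<psi> v) (\<lambda>_. True) u" for u
    by (simp add: is_arg_min_linorder)
  then have "u = u'" for u u' :: "real^'a"
    using wd unfolding prox_well_defined_def by blast
  then have "(axis i 1 :: real^'a) = 0" for i by blast
  then show False by (metis norm_axis_1 norm_zero zero_neq_one)
qed

text \<open>First-order optimality: with \<open>y = prox \<eta> \<psi> v\<close>, the vector \<open>(v - y) / \<eta>\<close> is a subgradient of
  \<open>\<psi>\<close> at \<open>y\<close>. Compare the minimizer with the point at parameter \<open>t\<close> on the segment towards
  \<open>u\<close>, bound \<open>\<psi>\<close> there by convexity, divide by \<open>t\<close>, and let \<open>t\<close> tend to \<open>0\<close>.\<close>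

lemma prox_variational_inequality:
  assumes conv: "ext_convex \<psi>" and wd: "prox_well_defined \<eta> \<psi>" and eta: "\<eta> > 0"
    and u: "\<psi> u = ereal q" and y: "\<psi> (prox \<eta> \<psi> v) = ereal p"
  shows "p + ((v - prox \<eta> \<psi> v) \<bullet> (u - prox \<eta> \<psi> v)) / \<eta> \<le> q"
proof -
  let ?y = "prox \<eta> \<psi> v"
  define d where "d = u - ?y"
  have step: "(v - ?y) \<bullet> d \<le> \<eta> * (q - p) + t / 2 * (norm d)\<^sup>2" if t: "0 < t" "t \<le> 1" for t
  proof -
    let ?u = "(1 - t) *\<^sub>R ?y + t *\<^sub>R u"
    have "prox_objective \<eta> \<psi> v ?y \<le> prox_objective \<eta> \<psi> v ?u"
      using prox_is_arg_min[OF wd, of v] by (simp add: is_arg_min_linorder)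
    moreover have cu: "\<psi> ?u \<le> ereal ((1 - t) * p + t * q)"
    proof -
      have "\<psi> ?u \<le> ereal (1 - t) * \<psi> ?y + ereal t * \<psi> u"
        using conv t unfolding ext_convex_def by (meson atLeastAtMost_iff less_imp_le)
      then show ?thesis by (simp add: u y)
    qed
    have "\<psi> ?u \<noteq> -\<infinity>" using conv by (simp add: ext_convex_def)
    with cu obtain s where s: "\<psi> ?u = ereal s" "s \<le> (1 - t) * p + t * q"
      by (cases "\<psi> ?u") auto
    have arith: "t * I \<le> Y - X + t\<^sup>2 * K / 2" if "X + A / 2 \<le> Y + (A - 2 * t * I + t\<^sup>2 * K) / 2"
      for I A K X Y :: real
      using that by (simp add: field_simps)
    have "?u - v = (?y - v) + t *\<^sub>R d" by (simp add: d_def algebra_simps)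
    ultimately have "\<eta> * p + (norm (?y - v))\<^sup>2 / 2 \<le> \<eta> * s + (norm ((?y - v) + t *\<^sub>R d))\<^sup>2 / 2"
      by (simp add: prox_objective_def y s(1))
    also have "\<dots> \<le> \<eta> * ((1 - t) * p + t * q) + (norm ((?y - v) + t *\<^sub>R d))\<^sup>2 / 2"
      using s(2) eta by simp
    also have "(norm ((?y - v) + t *\<^sub>R d))\<^sup>2 = (norm (?y - v))\<^sup>2 - 2 * t * ((v - ?y) \<bullet> d) + t\<^sup>2 * (norm d)\<^sup>2"
      unfolding power2_norm_eq_inner
      by (simp add: inner_add_left inner_add_right inner_diff_left inner_commute
          algebra_simps power2_eq_square)
    finally have "t * ((v - ?y) \<bullet> d) \<le> \<eta> * ((1 - t) * p + t * q) - \<eta> * p + t\<^sup>2 * (norm d)\<^sup>2 / 2"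
      by (rule arith)
    also have "\<dots> = t * (\<eta> * (q - p) + t / 2 * (norm d)\<^sup>2)"
      by (simp add: algebra_simps power2_eq_square)
    finally have "t * ((v - ?y) \<bullet> d) \<le> t * (\<eta> * (q - p) + t / 2 * (norm d)\<^sup>2)" .
    then show ?thesis using t(1) by simp
  qed
  have "(v - ?y) \<bullet> d \<le> \<eta> * (q - p)"
  proof (rule tendsto_lowerbound[of "\<lambda>t. \<eta> * (q - p) + t / 2 * (norm d)\<^sup>2" _ "at_right 0"])
    show "((\<lambda>t. \<eta> * (q - p) + t / 2 * (norm d)\<^sup>2) \<longlongrightarrow> \<eta> * (q - p)) (at_right 0)"
      by (auto intro!: tendsto_eq_intros)
    show "\<forall>\<^sub>F t in at_right 0. (v - ?y) \<bullet> d \<le> \<eta> * (q - p) + t / 2 * (norm d)\<^sup>2"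
      by (rule eventually_mono[OF eventually_at_right_real[of 0 1]]) (auto dest: step)
  qed simp
  then show ?thesis using eta by (simp add: d_def field_simps)
qed

text \<open>The estimator is unbiased: coordinate \<open>i\<close> is sampled with probability \<open>p\<^sub>i\<close> and then weighted by
  \<open>1 / p\<^sub>i\<close>.\<close>

lemma expectation_grad_estimator:
  assumes "\<And>i. incl_prob D i > 0"
  shows "measure_pmf.expectation D (\<lambda>S. grad_estimator f D x w S \<bullet> v) = grad f x \<bullet> v"
proof -
  let ?c = "\<lambda>i. 1 / incl_prob D i * (grad f x $ i - grad f w $ i) * v $ i"
  have int: "integrable (measure_pmf D) h" for h :: "'a set \<Rightarrow> real"
    by (rule integrable_measure_pmf_finite) simp
  have inner: "grad_estimator f D x w S \<bullet> v
      = grad f w \<bullet> v + (\<Sum>i\<in>UNIV. indicator {S. i \<in> S} S * ?c i)" for S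
  proof -
    have "(\<Sum>i\<in>S. (1 / incl_prob D i * (grad f x $ i - grad f w $ i)) *\<^sub>R axis i 1) \<bullet> v
        = (\<Sum>i\<in>S. ?c i)"
      by (simp add: inner_sum_left inner_axis')
    also have "\<dots> = (\<Sum>i\<in>UNIV. indicator {S. i \<in> S} S * ?c i)"
      by (rule sum.mono_neutral_cong_left) auto
    finally show ?thesis by (simp add: grad_estimator_def inner_add_left)
  qed
  have "measure_pmf.expectation D (\<lambda>S. grad_estimator f D x w S \<bullet> v)
      = grad f w \<bullet> v + (\<Sum>i\<in>UNIV. incl_prob D i * ?c i)"
    unfolding inner by (simp add: int incl_prob_def)
  also have "(\<Sum>i\<in>UNIV. incl_prob D i * ?c i) = (\<Sum>i\<in>UNIV. (grad f x - grad f w) $ i * v $ i)"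
    using assms by (intro sum.cong refl) (simp add: less_imp_neq[THEN not_sym])
  also have "\<dots> = (grad f x - grad f w) \<bullet> v" by (simp add: inner_vec_def)
  finally show ?thesis by (simp add: inner_diff_left)
qed

section \<open>One accelerated step\<close>

text \<open>The estimate behind acceleration, for one fixed outcome of the sampling. Here \<open>u\<close> is the
  point of comparison, \<open>g\<close> the estimator of the gradient \<open>G\<close> at \<open>x\<close>, and \<open>e\<close> the part of the error
  \<open>g - G\<close> that the displacement \<open>d = y' - x\<close> can see; \<open>p\<close>, \<open>qu\<close>, \<open>qw\<close> and \<open>qy\<close> are the values of the
  nonsmooth term at \<open>y'\<close>, \<open>u\<close>, \<open>w\<close> and \<open>y\<close>.

  Expanding \<open>z' - u\<close> produces the inner products of \<open>d\<close> with \<open>x - u\<close> and with \<open>z - x\<close>. Since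
  \<open>\<theta>1 (z - x) = \<theta>2 (x - w) + (1 - \<theta>1 - \<theta>2) (x - y)\<close> by the definition of \<open>x\<close>, these reduce to
  inner products of \<open>d\<close> with \<open>x - v\<close> for \<open>v\<close> among \<open>u\<close>, \<open>w\<close>, \<open>y\<close>, which the proximal
  inequality bounds by function values and by terms linear in \<open>g\<close>. The total weight with which
  the proximal inequality is used is \<open>c = 1 + (\<beta> / \<theta>1) (1 - \<theta>1)\<close>. The descent property then
  replaces \<open>g \<bullet> d\<close> by the decrease of the smooth part. Young's inequality with weight \<open>a\<close> separates
  the error \<open>e\<close> from \<open>d\<close>, and the condition on the coefficients makes all remaining multiples of
  \<open>norm d\<close> squared nonpositive.

  The estimator enters the bound only linearly and through the squared norm of \<open>e\<close>, so that
  unbiasedness and a variance bound determine its expectation.\<close>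

lemma accelerated_step_inequality:
  fixes x y z w u y' z' g G e :: "'a::real_inner"
  assumes par: "0 < \<eta>" "0 \<le> \<beta>" "\<beta> \<le> 1" "0 < \<gamma>" "0 < \<theta>1" "0 \<le> \<theta>2" "\<theta>1 + \<theta>2 \<le> 1" "0 < a"
    and c: "c = \<beta> / \<theta>1 + 1 - \<beta>"
    and coeff: "\<gamma> / \<eta>\<^sup>2 + c * (1 / a + L - 2 / \<eta>) \<le> 0"
    and x: "x = \<theta>1 *\<^sub>R z + \<theta>2 *\<^sub>R w + (1 - \<theta>1 - \<theta>2) *\<^sub>R y"
    and z': "z' = \<beta> *\<^sub>R z + (1 - \<beta>) *\<^sub>R x + (\<gamma> / \<eta>) *\<^sub>R (y' - x)"
    and prox: "\<And>v q. (v, q) \<in> {(u, qu), (w, qw), (y, qy)} \<Longrightarrow>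
        p + ((x - \<eta> *\<^sub>R g - y') \<bullet> (v - y')) / \<eta> \<le> q"
    and descent: "fy' \<le> fx + G \<bullet> (y' - x) + L / 2 * (norm (y' - x))\<^sup>2"
    and e: "(g - G) \<bullet> (y' - x) = e \<bullet> (y' - x)"
  shows "(norm (z' - u))\<^sup>2 + 2 * \<gamma> * c * (fy' + p)
    \<le> \<beta> * (norm (z - u))\<^sup>2 + (1 - \<beta>) * (norm (x - u))\<^sup>2
      + 2 * \<gamma> * (qu + g \<bullet> (u - x) + \<beta> / \<theta>1 * (\<theta>2 * (qw + g \<bullet> (w - x))
                 + (1 - \<theta>1 - \<theta>2) * (qy + g \<bullet> (y - x))) + c * fx)
      + \<gamma> * c * a * (norm e)\<^sup>2"
proof -
  (* R v q bounds A v by the proximal inequality at v; all these bounds share the term Q. *)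
  define d where "d = y' - x"
  define N where "N = (norm d)\<^sup>2"
  define Q where "Q = g \<bullet> d + N / \<eta>"
  define A where "A v = (d \<bullet> (x - v)) / \<eta>" for v
  define R where "R v q = q - p + g \<bullet> (v - x) - Q" for v q
  define \<theta>3 where "\<theta>3 = 1 - \<theta>1 - \<theta>2"
  have N0: "0 \<le> N" by (simp add: N_def)
  have dd: "d \<bullet> d = N" by (simp add: N_def power2_norm_eq_inner)
  have c0: "0 \<le> c"
  proof -
    have "0 \<le> \<beta> / \<theta>1" using par by simp
    then show ?thesis using par unfolding c by linarith
  qed
  have \<theta>3: "0 \<le> \<theta>3" using par by (simp add: \<theta>3_def)
  have A_le: "A v \<le> R v q" if "(v, q) \<in> {(u, qu), (w, qw), (y, qy)}" for v q
  proof -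
    have "(x - \<eta> *\<^sub>R g - y') \<bullet> (v - y') = (- d - \<eta> *\<^sub>R g) \<bullet> ((v - x) - d)"
      by (simp add: d_def algebra_simps)
    also have "\<dots> = d \<bullet> (x - v) + N - \<eta> * (g \<bullet> (v - x)) + \<eta> * (g \<bullet> d)"
      using dd by (simp add: inner_diff_left inner_diff_right algebra_simps)
    finally have "((x - \<eta> *\<^sub>R g - y') \<bullet> (v - y')) / \<eta> = A v + N / \<eta> - g \<bullet> (v - x) + g \<bullet> d"
      using par(1) by (simp add: A_def add_divide_distrib diff_divide_distrib)
    with prox[OF that] show ?thesis by (simp add: R_def Q_def)
  qed
  have Az: "(d \<bullet> (z - x)) / \<eta> = (\<theta>2 * A w + \<theta>3 * A y) / \<theta>1"
  proof -
    have "\<theta>1 *\<^sub>R (z - x) = \<theta>2 *\<^sub>R (x - w) + \<theta>3 *\<^sub>R (x - y)"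
      by (simp add: x \<theta>3_def algebra_simps)
    then have "\<theta>1 * (d \<bullet> (z - x)) = \<theta>2 * (d \<bullet> (x - w)) + \<theta>3 * (d \<bullet> (x - y))"
      by (metis inner_add_right inner_scaleR_right)
    then show ?thesis using par(1,5) by (simp add: A_def field_simps)
  qed
  have z_le: "(norm (z' - u))\<^sup>2 \<le> \<beta> * (norm (z - u))\<^sup>2 + (1 - \<beta>) * (norm (x - u))\<^sup>2
      + 2 * \<gamma> * (A u + \<beta> * ((d \<bullet> (z - x)) / \<eta>)) + \<gamma>\<^sup>2 / \<eta>\<^sup>2 * N"
  proof -
    define s where "s = \<beta> *\<^sub>R (z - u) + (1 - \<beta>) *\<^sub>R (x - u)"
    have "z' - u = s + (\<gamma> / \<eta>) *\<^sub>R d"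
      by (simp add: z' s_def d_def algebra_simps)
    then have "(norm (z' - u))\<^sup>2 = (norm s)\<^sup>2 + 2 * (\<gamma> / \<eta>) * (d \<bullet> s) + (\<gamma> / \<eta>)\<^sup>2 * N"
      unfolding N_def power2_norm_eq_inner
      by (simp add: inner_add_left inner_add_right inner_commute power2_eq_square)
    moreover have "(norm s)\<^sup>2 = \<beta> * (norm (z - u))\<^sup>2 + (1 - \<beta>) * (norm (x - u))\<^sup>2
        - \<beta> * (1 - \<beta>) * (norm ((z - u) - (x - u)))\<^sup>2"
      unfolding s_def power2_norm_eq_inner
      by (simp only: inner_add_left inner_add_right inner_scaleR_left inner_scaleR_right
          inner_diff_left inner_diff_right inner_commute) (simp add: algebra_simps)
    moreover have "0 \<le> \<beta> * (1 - \<beta>) * (norm ((z - u) - (x - u)))\<^sup>2"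
      using par by simp
    moreover have "d \<bullet> s = d \<bullet> (x - u) + \<beta> * (d \<bullet> (z - x))"
    proof -
      have "s = (x - u) + \<beta> *\<^sub>R (z - x)" by (simp add: s_def algebra_simps)
      then show ?thesis by (simp add: inner_add_right)
    qed
    moreover have "2 * (\<gamma> / \<eta>) * (d \<bullet> (x - u) + \<beta> * (d \<bullet> (z - x)))
        = 2 * \<gamma> * (A u + \<beta> * ((d \<bullet> (z - x)) / \<eta>))"
      using par(1) by (simp add: A_def field_simps)
    ultimately show ?thesis by (simp add: power_divide)
  qed
  have Q_le: "- Q \<le> fx - fy' + a / 2 * (norm e)\<^sup>2 + N * (1 / (2 * a) + L / 2 - 1 / \<eta>)"
  proof -
    (* Young's inequality for - e \<bullet> d with weight a. *)
    have "0 \<le> (norm (a *\<^sub>R e + d))\<^sup>2" by simp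
    also have "\<dots> = a\<^sup>2 * (norm e)\<^sup>2 + 2 * a * (e \<bullet> d) + N"
      unfolding N_def power2_norm_eq_inner
      by (simp add: inner_add_left inner_add_right inner_commute power2_eq_square)
    finally have "- (e \<bullet> d) \<le> a / 2 * (norm e)\<^sup>2 + N / (2 * a)"
      using par(8) by (simp add: field_simps power2_eq_square)
    moreover have "g \<bullet> d = G \<bullet> d + e \<bullet> d" using e by (simp add: d_def inner_diff_left)
    moreover have "fy' \<le> fx + G \<bullet> d + L / 2 * N" using descent by (simp add: d_def N_def)
    ultimately show ?thesis unfolding Q_def by (simp add: algebra_simps)
  qed
  have ct: "1 + \<beta> / \<theta>1 * (\<theta>2 + \<theta>3) = c" using par(5) by (simp add: c \<theta>3_def field_simps)
  have regroup: "R u qu + k * (\<theta>2 * R w qw + \<theta>3 * R y qy)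
      = qu + g \<bullet> (u - x) + k * (\<theta>2 * (qw + g \<bullet> (w - x)) + \<theta>3 * (qy + g \<bullet> (y - x)))
        + (1 + k * (\<theta>2 + \<theta>3)) * (- p - Q)" for k
    by (simp add: R_def algebra_simps)
  have "A u + \<beta> * ((d \<bullet> (z - x)) / \<eta>) = A u + \<beta> / \<theta>1 * (\<theta>2 * A w + \<theta>3 * A y)"
    by (simp add: Az)
  also have "\<dots> \<le> R u qu + \<beta> / \<theta>1 * (\<theta>2 * R w qw + \<theta>3 * R y qy)"
    using A_le par \<theta>3 by (intro add_mono mult_left_mono) auto
  also have "\<dots> = qu + g \<bullet> (u - x) + \<beta> / \<theta>1 * (\<theta>2 * (qw + g \<bullet> (w - x)) + \<theta>3 * (qy + g \<bullet> (y - x)))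
      + (1 + \<beta> / \<theta>1 * (\<theta>2 + \<theta>3)) * (- p - Q)"
    by (rule regroup)
  also have "\<dots> \<le> qu + g \<bullet> (u - x) + \<beta> / \<theta>1 * (\<theta>2 * (qw + g \<bullet> (w - x)) + \<theta>3 * (qy + g \<bullet> (y - x)))
      + c * (- p + (fx - fy' + a / 2 * (norm e)\<^sup>2 + N * (1 / (2 * a) + L / 2 - 1 / \<eta>)))"
    unfolding ct using c0 Q_le by (intro add_left_mono mult_left_mono) auto
  finally have main: "A u + \<beta> * ((d \<bullet> (z - x)) / \<eta>) \<le> qu + g \<bullet> (u - x)
      + \<beta> / \<theta>1 * (\<theta>2 * (qw + g \<bullet> (w - x)) + \<theta>3 * (qy + g \<bullet> (y - x)))
      + c * (- p + (fx - fy' + a / 2 * (norm e)\<^sup>2 + N * (1 / (2 * a) + L / 2 - 1 / \<eta>)))"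
    (is "_ \<le> ?B + c * (- p + (fx - fy' + _ + N * ?k))") .
  have "\<gamma> * N * (\<gamma> / \<eta>\<^sup>2 + c * (1 / a + L - 2 / \<eta>)) \<le> 0"
    using coeff N0 par(4) by (simp add: mult_nonneg_nonpos)
  moreover have "\<gamma> * N * (\<gamma> / \<eta>\<^sup>2 + c * (1 / a + L - 2 / \<eta>)) = \<gamma>\<^sup>2 / \<eta>\<^sup>2 * N + 2 * \<gamma> * (c * (N * ?k))"
    by (simp add: algebra_simps power2_eq_square)
  moreover have "2 * \<gamma> * (A u + \<beta> * ((d \<bullet> (z - x)) / \<eta>)) \<le> 2 * \<gamma> * (?B
      + c * (- p + (fx - fy' + a / 2 * (norm e)\<^sup>2 + N * ?k)))"
    using main par(4) by (intro mult_left_mono) auto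
  moreover have "2 * \<gamma> * (?B + c * (- p + (fx - fy' + a / 2 * (norm e)\<^sup>2 + N * ?k)))
      = 2 * \<gamma> * (?B + c * fx) + \<gamma> * c * a * (norm e)\<^sup>2 - 2 * \<gamma> * c * (fy' + p) + 2 * \<gamma> * (c * (N * ?k))"
    by (simp add: algebra_simps)
  ultimately show ?thesis using z_le unfolding \<theta>3_def by linarith
qed


section \<open>Parameters and rates\<close>

text \<open>With \<open>\<Lambda> = max L L'\<close> the choices read \<open>\<eta> = 1 / (4 \<Lambda>)\<close> and \<open>\<theta>2 = L' / (2 \<Lambda>)\<close>, hence
  \<open>\<theta>2 / L' = 2 \<eta>\<close>.\<close>

locale asvrcd_parameters =
  fixes \<mu> L L' \<theta>1 \<theta>2 \<eta> \<beta> \<gamma> \<rho> :: real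
  assumes mu_pos: "\<mu> > 0" and L_nonneg: "L \<ge> 0" and L'_pos: "L' > 0"
    and rho: "0 < \<rho>" "\<rho> < 1"
    and eta_eq: "\<eta> = 1/4 * inverse (max L' L)"
    and theta2_eq: "\<theta>2 = L' / (2 * max L L')"
    and gamma_eq: "\<gamma> = 1 / max (2 * \<mu>) (4 * \<theta>1 / \<eta>)"
    and beta_eq: "\<beta> = 1 - \<gamma> * \<mu>"
    and theta1_eq: "\<theta>1 = min (1/2) (sqrt (\<eta> * \<mu> * max (1/2) (\<theta>2 / \<rho>)))"
begin

abbreviation "rate \<equiv> 1/4 * min \<rho> (sqrt (\<mu> / (2 * max L (L' / \<rho>))))"

lemma max_L_pos: "0 < max L L'" using L'_pos by simp

lemma eta_eq': "\<eta> = 1 / (4 * max L L')"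
  by (simp add: eta_eq field_simps max.commute)

lemma eta_pos: "0 < \<eta>" unfolding eta_eq' using max_L_pos by (intro divide_pos_pos) auto

lemma L_le_eta: "L \<le> 1 / (4 * \<eta>)" by (simp add: eta_eq')

lemma theta2_bounds: "0 < \<theta>2" "\<theta>2 \<le> 1/2"
  using max_L_pos L'_pos by (auto simp: theta2_eq divide_simps)

lemma theta2_over_L': "\<theta>2 / L' = 2 * \<eta>"
  using L'_pos by (simp add: theta2_eq eta_eq')

lemma theta1_bounds: "0 < \<theta>1" "\<theta>1 \<le> 1/2"
proof -
  have "0 < max (1/2) (\<theta>2 / \<rho>)" by (simp add: less_max_iff_disj)
  then show "0 < \<theta>1" using eta_pos mu_pos by (simp add: theta1_eq)
qed (simp add: theta1_eq)

lemma gamma_pos: "0 < \<gamma>"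
  using mu_pos by (simp add: gamma_eq less_max_iff_disj)

lemma gamma_le: "\<gamma> \<le> \<eta> / (4 * \<theta>1)" "\<gamma> * \<mu> \<le> 1/2"
proof -
  have p: "0 < 4 * \<theta>1 / \<eta>" using theta1_bounds eta_pos by simp
  have "\<gamma> \<le> 1 / (4 * \<theta>1 / \<eta>)" unfolding gamma_eq using p mu_pos by (intro divide_left_mono mult_pos_pos) (auto simp: less_max_iff_disj)
  then show "\<gamma> \<le> \<eta> / (4 * \<theta>1)" by simp
  have "\<gamma> \<le> 1 / (2 * \<mu>)" unfolding gamma_eq using mu_pos by (intro divide_left_mono mult_pos_pos) (auto simp: less_max_iff_disj)
  then show "\<gamma> * \<mu> \<le> 1/2" using mu_pos by (simp add: field_simps)
qed

lemma beta_bounds: "1/2 \<le> \<beta>" "\<beta> < 1"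
  using gamma_le gamma_pos mu_pos by (auto simp: beta_eq)

text \<open>\<open>total_weight\<close> is the weight with which the proximal and descent inequalities are used in one step.
  \<open>noise_weight\<close> is the weight for Young's inequality: it is chosen such that the variance of
  the estimator, which is at most \<open>2 L' D\<^sub>f(w, x)\<close>, is multiplied by exactly the factor that the
  negative multiple of \<open>D\<^sub>f(w, x)\<close> from the comparison with \<open>w\<close> can absorb.\<close>

definition "total_weight = \<beta> / \<theta>1 + 1 - \<beta>"
definition "noise_weight = \<theta>2 / L' * (\<beta> / \<theta>1) / total_weight"

lemma total_weight_ge: "\<beta> / \<theta>1 \<le> total_weight" "0 < total_weight"
proof -
  show "\<beta> / \<theta>1 \<le> total_weight" using beta_bounds by (simp add: total_weight_def)
  moreover have "0 < \<beta> / \<theta>1" using beta_bounds theta1_bounds by simp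
  ultimately show "0 < total_weight" by linarith
qed

lemma noise_weight_pos: "0 < noise_weight"
  using theta2_bounds L'_pos beta_bounds theta1_bounds total_weight_ge by (simp add: noise_weight_def)

lemma total_weight_times_noise_weight: "total_weight * noise_weight = \<beta> / \<theta>1 * \<theta>2 / L'"
  using total_weight_ge by (simp add: noise_weight_def mult.commute)

text \<open>The correction \<open>1 - \<beta>\<close> in \<open>total_weight\<close> costs at most a factor \<open>3 / 2\<close>, so \<open>1 / noise_weight\<close> is at
  most \<open>3 / (4 \<eta>)\<close>. Together with \<open>L \<le> 1 / (4 \<eta>)\<close> this leaves the slack \<open>- 1 / \<eta>\<close>, which pays for
  the quadratic term because \<open>\<gamma> \<le> \<eta> / (4 \<theta>1)\<close>.\<close>

lemma step_length_condition: "\<gamma> / \<eta>\<^sup>2 + total_weight * (1 / noise_weight + L - 2 / \<eta>) \<le> 0"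
proof -
  have "total_weight * \<theta>1 / \<beta> = 1 + \<theta>1 * (1 - \<beta>) / \<beta>"
    using theta1_bounds beta_bounds by (simp add: total_weight_def field_simps)
  also have "\<dots> \<le> 3 / 2"
  proof -
    have "\<theta>1 * (1 - \<beta>) \<le> 1/2 * \<beta>"
      using theta1_bounds beta_bounds by (intro mult_mono) auto
    then show ?thesis using beta_bounds by (simp add: field_simps)
  qed
  finally have k: "total_weight * \<theta>1 / \<beta> \<le> 3 / 2" .
  have "1 / noise_weight = (total_weight * \<theta>1 / \<beta>) / (2 * \<eta>)"
    unfolding noise_weight_def theta2_over_L' by (simp add: mult.commute)
  also have "\<dots> \<le> (3 / 2) / (2 * \<eta>)" using k eta_pos by (intro divide_right_mono) auto
  finally have "1 / noise_weight + L - 2 / \<eta> \<le> (3 / 2) / (2 * \<eta>) + 1 / (4 * \<eta>) - 2 / \<eta>"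
    using L_le_eta by linarith
  also have "\<dots> = - (1 / \<eta>)" using eta_pos by (simp add: field_simps)
  finally have "total_weight * (1 / noise_weight + L - 2 / \<eta>) \<le> total_weight * (- (1 / \<eta>))"
    using total_weight_ge by (intro mult_left_mono) auto
  also have "\<dots> = - (total_weight / \<eta>)" by simp
  finally have "total_weight * (1 / noise_weight + L - 2 / \<eta>) \<le> - (total_weight / \<eta>)" .
  moreover have "\<gamma> / \<eta>\<^sup>2 \<le> total_weight / \<eta>"
  proof -
    have "\<gamma> \<le> \<eta> * (1 / (4 * \<theta>1))" using gamma_le by simp
    also have "\<dots> \<le> \<eta> * (\<beta> / \<theta>1)"
      using beta_bounds theta1_bounds eta_pos by (intro mult_left_mono) (auto simp: field_simps)
    also have "\<dots> \<le> \<eta> * total_weight" using total_weight_ge eta_pos by (intro mult_left_mono) auto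
    finally show ?thesis using eta_pos by (simp add: field_simps power2_eq_square)
  qed
  ultimately have "\<gamma> / \<eta>\<^sup>2 + total_weight * (1 / noise_weight + L - 2 / \<eta>) \<le> total_weight / \<eta> + - (total_weight / \<eta>)"
    by (intro add_mono)
  then show ?thesis by simp
qed

text \<open>\<open>N\<close> is the smoothness constant that governs the accelerated rate, and \<open>s\<close> is that rate up to a
  constant. In these terms \<open>\<theta>1\<close> is the minimum of \<open>1 / 2\<close> and \<open>s N / (2 \<Lambda>)\<close>, from which all
  estimates of the rate follow by elementary means.\<close>

context
  fixes N s
  assumes N: "N = max L (L' / \<rho>)" and s: "s = sqrt (\<mu> / (2 * N))"
begin

lemma N_ge: "max L L' \<le> N" "L' / \<rho> \<le> N"
proof -
  have "L' \<le> L' / \<rho>" using rho L'_pos by (simp add: field_simps)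
  then show "max L L' \<le> N" "L' / \<rho> \<le> N" by (auto simp: N)
qed

lemma N_pos: "0 < N" using N_ge max_L_pos by linarith

lemma s_pos: "0 < s" using N_pos mu_pos by (simp add: s)

lemma s_sq: "s\<^sup>2 = \<mu> / (2 * N)" using N_pos mu_pos by (simp add: s)

lemma theta1_as_min: "\<theta>1 = min (1/2) (s * N / (2 * max L L'))"
proof -
  let ?m = "max L L'"
  have "max (1/2) (\<theta>2 / \<rho>) = N / (2 * ?m)"
  proof -
    have "max (1/2) (\<theta>2 / \<rho>) = max (?m / (2 * ?m)) ((L' / \<rho>) / (2 * ?m))"
      using max_L_pos by (simp add: theta2_eq mult.commute)
    also have "\<dots> = max ?m (L' / \<rho>) / (2 * ?m)"
      using max_L_pos by (simp add: max_divide_distrib_right)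
    also have "max ?m (L' / \<rho>) = N" using N_ge by (auto simp: N)
    finally show ?thesis .
  qed
  then have "\<eta> * \<mu> * max (1/2) (\<theta>2 / \<rho>) = (\<mu> / (2 * N)) * (N / (2 * ?m))\<^sup>2"
    using max_L_pos N_pos by (simp add: eta_eq' power2_eq_square)
  also have "\<dots> = (s * (N / (2 * ?m)))\<^sup>2" by (simp add: power_mult_distrib power_divide s_sq)
  finally have "sqrt (\<eta> * \<mu> * max (1/2) (\<theta>2 / \<rho>)) = s * N / (2 * ?m)"
    using s_pos N_pos max_L_pos by (simp add: real_sqrt_abs)
  then show ?thesis by (simp add: theta1_eq)
qed

lemma rate_le_beta: "1/4 * min \<rho> s \<le> 1 - \<beta>"
proof (cases "4 * \<theta>1 / \<eta> \<le> 2 * \<mu>")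
  case True
  then have "1 - \<beta> = 1/2" using mu_pos by (simp add: beta_eq gamma_eq)
  then show ?thesis using rho by simp
next
  case False
  then have "1 - \<beta> = \<mu> * \<eta> / (4 * \<theta>1)" by (simp add: beta_eq gamma_eq)
  moreover have "\<mu> * \<eta> / (4 * (s * N / (2 * max L L'))) \<le> \<mu> * \<eta> / (4 * \<theta>1)"
    using theta1_bounds mu_pos eta_pos s_pos N_pos max_L_pos
    by (intro divide_left_mono mult_left_mono) (auto simp: theta1_as_min intro!: mult_pos_pos divide_pos_pos)
  moreover have "\<mu> * \<eta> / (4 * (s * N / (2 * max L L'))) = \<mu> / (8 * s * N)"
    using max_L_pos by (simp add: eta_eq' field_simps)
  moreover have "\<mu> / (8 * s * N) = 1/4 * s"
    using s_sq s_pos N_pos by (simp add: field_simps power2_eq_square)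
  ultimately have "1/4 * s \<le> 1 - \<beta>" by linarith
  then show ?thesis by linarith
qed

lemma s_half_le: "s / 2 \<le> s * N / (2 * max L L')"
proof -
  have "s / 2 * (2 * max L L') \<le> s * N" using N_ge(1) s_pos by (simp del: max.bounded_iff)
  then show ?thesis using max_L_pos by (subst pos_le_divide_eq) simp_all
qed

lemma rate_le_theta1: "1/4 * min \<rho> s \<le> \<theta>1 / 2"
  unfolding theta1_as_min using s_half_le rho by (auto simp: min_def)

text \<open>The weight of the reference point contracts at the rate \<open>\<rho> / 2\<close> if \<open>\<theta>1\<close> dominates \<open>2 \<theta>2\<close>.
  Otherwise the rate is at least \<open>\<rho> \<theta>1 / (4 \<theta>2)\<close>, and the bound follows from \<open>\<theta>2 \<le> 1 / 2\<close> or, when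
  \<open>\<theta>1 < 1 / 2\<close>, from \<open>N \<ge> L' / \<rho>\<close>.\<close>

lemma rate_le_snapshot: "1/4 * min \<rho> s \<le> \<rho> * \<theta>1 / (2 * \<theta>2 + \<theta>1)"
proof (cases "2 * \<theta>2 \<le> \<theta>1")
  case True
  have "\<rho> * \<theta>1 / (2 * \<theta>1) \<le> \<rho> * \<theta>1 / (2 * \<theta>2 + \<theta>1)"
    using True theta1_bounds theta2_bounds rho by (intro divide_left_mono) auto
  moreover have "\<rho> * \<theta>1 / (2 * \<theta>1) = \<rho> / 2" using theta1_bounds by simp
  ultimately show ?thesis using rho by linarith
next
  case False
  have *: "\<rho> * \<theta>1 / (4 * \<theta>2) \<le> \<rho> * \<theta>1 / (2 * \<theta>2 + \<theta>1)"
    using False theta1_bounds theta2_bounds rho by (intro divide_left_mono) auto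
  show ?thesis
  proof (cases "\<theta>1 = 1/2")
    case True
    have "\<rho> / 4 \<le> \<rho> * \<theta>1 / (4 * \<theta>2)"
      using True theta2_bounds rho by (simp add: field_simps)
    then show ?thesis using * by linarith
  next
    case False
    then have "\<theta>1 = s * N / (2 * max L L')" by (auto simp: theta1_as_min min_def split: if_splits)
    moreover have "\<rho> * (s * N / (2 * m)) / (4 * (L' / (2 * m))) = s * (\<rho> * N / L') / 4"
      if "0 < m" for m
      using that L'_pos by (simp add: field_simps)
    ultimately have "\<rho> * \<theta>1 / (4 * \<theta>2) = s * (\<rho> * N / L') / 4"
      using max_L_pos by (simp only: theta2_eq)
    moreover have "1 \<le> \<rho> * N / L'" using N_ge rho L'_pos by (simp add: field_simps)
    then have "s * 1 / 4 \<le> s * (\<rho> * N / L') / 4"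
      using s_pos by (intro divide_right_mono mult_left_mono) auto
    ultimately have "s * 1 / 4 \<le> \<rho> * \<theta>1 / (2 * \<theta>2 + \<theta>1)" using * by (metis order_trans)
    then show ?thesis by linarith
  qed
qed

text \<open>The inverse of the rate is \<open>4 max (1 / \<rho>) (1 / s)\<close>, where \<open>1 / s = sqrt 2 * sqrt (N / \<mu>)\<close> and \<open>N\<close> is one
  of \<open>L\<close> and \<open>L' / \<rho>\<close>. The constant \<open>8\<close> leaves room for the factor \<open>4 sqrt 2\<close>.\<close>

lemma complexity_bound: "1 \<le> 8 * (1 / \<rho> + sqrt (L / \<mu>) + sqrt (L' / (\<rho> * \<mu>))) * (1/4 * min \<rho> s)"
proof -
  let ?A = "sqrt (L / \<mu>)" and ?B = "sqrt (L' / (\<rho> * \<mu>))"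
  have AB: "0 \<le> ?A" "0 \<le> ?B" using L_nonneg L'_pos mu_pos rho by auto
  have 1: "1 \<le> 8 * (1 / \<rho> + A + B) * (1/4 * \<rho>)" if "0 \<le> A" "0 \<le> B" for A B
  proof -
    have "8 * (1 / \<rho> + A + B) * (1/4 * \<rho>) = 2 + 2 * (A + B) * \<rho>"
      using rho by (simp add: field_simps)
    moreover have "0 \<le> 2 * (A + B) * \<rho>" using that rho by simp
    ultimately show ?thesis by linarith
  qed
  have le: "sqrt (N / \<mu>) \<le> ?A + ?B"
  proof (cases "L \<le> L' / \<rho>")
    case True
    then have eq: "N / \<mu> = L' / (\<rho> * \<mu>)" by (simp add: N)
    show ?thesis unfolding eq using AB by linarith
  next
    case False
    then have eq: "N / \<mu> = L / \<mu>" by (simp add: N)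
    show ?thesis unfolding eq using AB by linarith
  qed
  have arith: "2 * s * T = 8 * T * (1/4 * s)" for T by simp
  have "1 \<le> 2 * s * sqrt (N / \<mu>)"
  proof -
    have "(2 * s * sqrt (N / \<mu>))\<^sup>2 = 4 * s\<^sup>2 * (N / \<mu>)"
      using N_pos mu_pos by (simp add: power_mult_distrib)
    also have "\<dots> = 2" unfolding s_sq using N_pos mu_pos by simp
    finally have "1\<^sup>2 \<le> (2 * s * sqrt (N / \<mu>))\<^sup>2" by simp
    moreover have "0 \<le> 2 * s * sqrt (N / \<mu>)" using s_pos N_pos mu_pos by simp
    ultimately show ?thesis by (rule power2_le_imp_le)
  qed
  also have "\<dots> \<le> 2 * s * (1 / \<rho> + ?A + ?B)"
  proof (rule mult_left_mono)
    have "0 \<le> 1 / \<rho>" using rho by simp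
    then show "sqrt (N / \<mu>) \<le> 1 / \<rho> + ?A + ?B" using le by linarith
  qed (use s_pos in simp)
  also have "\<dots> = 8 * (1 / \<rho> + ?A + ?B) * (1/4 * s)"
    by (rule arith)
  finally have 2: "1 \<le> 8 * (1 / \<rho> + ?A + ?B) * (1/4 * s)" .
  show ?thesis using 1[OF AB] 2 unfolding min_def by (cases "\<rho> \<le> s") (simp_all only: if_True if_False)
qed

end

lemma rate_pos: "0 < rate" and rate_le_quarter: "rate \<le> 1/4"
  using rho s_pos[OF refl refl] by auto

text \<open>The three parts of the potential contract by the factors \<open>\<beta>\<close>, \<open>1 - \<theta>1 / 2\<close> and
  \<open>1 - \<rho> \<theta>1 / (2 \<theta>2 + \<theta>1)\<close>. Replacing \<open>w\<close> by \<open>y\<close> with probability \<open>\<rho>\<close> adds \<open>\<theta>2 + \<theta>1 / 2\<close> times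
  the weight of \<open>y\<close> to the coefficient of the gap at \<open>y\<close>: this turns the factor \<open>1 - \<theta>1 - \<theta>2\<close>
  into \<open>1 - \<theta>1 / 2\<close>, and is why the gap at \<open>w\<close> carries the weight \<open>2 \<theta>2 + \<theta>1\<close> in the potential.\<close>

lemma potential_weights_contract:
  "\<beta> \<le> 1 - rate"
  "2 * \<gamma> * \<beta> / \<theta>1 * (1 - \<theta>1 - \<theta>2) + (2 * \<theta>2 + \<theta>1) * \<gamma> * \<beta> / (\<theta>1 * \<rho>) * \<rho>
    \<le> (1 - rate) * (2 * \<gamma> * \<beta> / \<theta>1)"
  "2 * \<gamma> * \<beta> / \<theta>1 * \<theta>2 + (2 * \<theta>2 + \<theta>1) * \<gamma> * \<beta> / (\<theta>1 * \<rho>) * (1 - \<rho>)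
    \<le> (1 - rate) * ((2 * \<theta>2 + \<theta>1) * \<gamma> * \<beta> / (\<theta>1 * \<rho>))"
proof -
  have rates: "rate \<le> 1 - \<beta>" "rate \<le> \<theta>1 / 2" "rate \<le> \<rho> * \<theta>1 / (2 * \<theta>2 + \<theta>1)"
    by (rule rate_le_beta[OF refl refl] rate_le_theta1[OF refl refl] rate_le_snapshot[OF refl refl])+
  have pos: "0 < 2 * \<theta>2 + \<theta>1" using theta1_bounds theta2_bounds by simp
  show "\<beta> \<le> 1 - rate" using rates(1) by simp
  have "2 * \<gamma> * \<beta> / \<theta>1 * (1 - \<theta>1 - \<theta>2) + (2 * \<theta>2 + \<theta>1) * \<gamma> * \<beta> / (\<theta>1 * \<rho>) * \<rho>
      = (1 - \<theta>1 / 2) * (2 * \<gamma> * \<beta> / \<theta>1)"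
    using theta1_bounds rho by (simp add: field_simps)
  also have "\<dots> \<le> (1 - rate) * (2 * \<gamma> * \<beta> / \<theta>1)"
    using rates(2) theta1_bounds gamma_pos beta_bounds by (intro mult_right_mono) auto
  finally show "2 * \<gamma> * \<beta> / \<theta>1 * (1 - \<theta>1 - \<theta>2) + (2 * \<theta>2 + \<theta>1) * \<gamma> * \<beta> / (\<theta>1 * \<rho>) * \<rho>
    \<le> (1 - rate) * (2 * \<gamma> * \<beta> / \<theta>1)" .
  have snap: "2 * \<gamma> * \<beta> / \<theta>1 * \<theta>2 = (\<rho> - \<rho> * \<theta>1 / q) * (q * \<gamma> * \<beta> / (\<theta>1 * \<rho>))"
    if "q = 2 * \<theta>2 + \<theta>1" for q
  proof -
    have "q \<noteq> 0" using that pos by simp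
    then have "\<rho> - \<rho> * \<theta>1 / q = \<rho> * (2 * \<theta>2) / q"
      by (simp add: diff_divide_eq_iff that algebra_simps)
    then show ?thesis using \<open>q \<noteq> 0\<close> rho by simp
  qed
  have arith: "X + K * (1 - \<rho>) = (1 - t) * K" if "X = (\<rho> - t) * K" for X K t :: real
    using that by (simp add: algebra_simps)
  have "2 * \<gamma> * \<beta> / \<theta>1 * \<theta>2 + (2 * \<theta>2 + \<theta>1) * \<gamma> * \<beta> / (\<theta>1 * \<rho>) * (1 - \<rho>)
      = (1 - \<rho> * \<theta>1 / (2 * \<theta>2 + \<theta>1)) * ((2 * \<theta>2 + \<theta>1) * \<gamma> * \<beta> / (\<theta>1 * \<rho>))"
    by (rule arith[OF snap[OF refl]])
  also have "\<dots> \<le> (1 - rate) * ((2 * \<theta>2 + \<theta>1) * \<gamma> * \<beta> / (\<theta>1 * \<rho>))"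
    using rates(3) theta1_bounds theta2_bounds gamma_pos beta_bounds rho by (intro mult_right_mono) auto
  finally show "2 * \<gamma> * \<beta> / \<theta>1 * \<theta>2 + (2 * \<theta>2 + \<theta>1) * \<gamma> * \<beta> / (\<theta>1 * \<rho>) * (1 - \<rho>)
    \<le> (1 - rate) * ((2 * \<theta>2 + \<theta>1) * \<gamma> * \<beta> / (\<theta>1 * \<rho>))" .
qed

end


section \<open>Expected decrease of the potential\<close>

lemma affine_affine_range: "affine (affine_range x0 W)"
  unfolding affine_range_def
  by (intro affine_translation[THEN iffD1] subspace_imp_affine linear_subspace_image
        matrix_vector_mul_linear subspace_UNIV)

lemma base_in_affine_range: "x0 \<in> affine_range x0 W"
  unfolding affine_range_def by (rule image_eqI[of _ _ 0]) (auto intro!: range_eqI[of _ _ 0])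

lemma diff_affine_range:
  assumes "u \<in> affine_range x0 W" "v \<in> affine_range x0 W"
  shows "u - v \<in> range ((*v) W)"
proof -
  obtain a b where "u = x0 + W *v a" "v = x0 + W *v b"
    using assms by (auto simp: affine_range_def)
  then show ?thesis by (intro range_eqI[of _ _ "a - b"]) (simp add: matrix_vector_mult_diff_distrib)
qed

text \<open>All points of the method stay in the affine space \<open>affine_range x0 W\<close>. There \<open>f\<close> is
  \<open>L\<close>-smooth and \<open>\<mu>\<close>-strongly convex in the Euclidean norm, and only there can \<open>\<psi>\<close> be finite.\<close>

locale asvrcd_problem = asvrcd_parameters +
  fixes f :: "real^'d::finite \<Rightarrow> real" and \<psi> :: "real^'d \<Rightarrow> ereal" and D :: "'d set pmf"
    and W :: "real^'d^'d" and x0 xstar :: "real^'d"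
  assumes psi_convex: "ext_convex \<psi>"
    and psi_domain: "\<And>v. \<psi> v \<noteq> \<infinity> \<Longrightarrow> v \<in> affine_range x0 W"
    and xstar_min: "is_arg_min (objective f \<psi>) (\<lambda>_. True) xstar"
    and W_proj: "projection_matrix W"
    and smooth: "\<And>u v. u \<in> affine_range x0 W \<Longrightarrow> v \<in> affine_range x0 W \<Longrightarrow>
      f u \<le> f v + grad f v \<bullet> (u - v) + L / 2 * (norm (u - v))\<^sup>2"
    and strong: "strongly_convex_over (affine_range x0 W) \<mu> f"
    and p_pos: "\<And>i. incl_prob D i > 0"
    and prox_wd: "prox_well_defined \<eta> \<psi>"
begin

abbreviation "H \<equiv> affine_range x0 W"
abbreviation "E \<equiv> measure_pmf.expectation D"
abbreviation "iter \<equiv> asvrcd f \<psi> D \<theta>1 \<theta>2 \<eta> \<beta> \<gamma> \<rho> x0"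
abbreviation "step \<equiv> asvrcd_step f \<psi> D \<theta>1 \<theta>2 \<eta> \<beta> \<gamma> \<rho>"
abbreviation "\<Psi> \<equiv> potential f \<psi> \<theta>1 \<theta>2 \<beta> \<gamma> \<rho> xstar"

definition "g_next x w S = grad_estimator f D x w S"
definition "y_next x w S = prox \<eta> \<psi> (x - \<eta> *\<^sub>R g_next x w S)"
definition "z_next x z w S = \<beta> *\<^sub>R z + (1 - \<beta>) *\<^sub>R x + (\<gamma> / \<eta>) *\<^sub>R (y_next x w S - x)"

text \<open>The gap \<open>P v - P xstar\<close> as a real number, meaningful where \<open>\<psi>\<close> is finite.\<close>

definition "gap v = f v + real_of_ereal (\<psi> v) - (f xstar + real_of_ereal (\<psi> xstar))"

lemma psi_real: "\<psi> v \<noteq> \<infinity> \<Longrightarrow> \<psi> v = ereal (real_of_ereal (\<psi> v))"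
  using psi_convex by (cases "\<psi> v") (auto simp: ext_convex_def)

lemma psi_y_next: "\<psi> (y_next x w S) \<noteq> \<infinity>"
  unfolding y_next_def by (rule prox_finite[OF prox_wd eta_pos])

lemma xstar_le: "objective f \<psi> xstar \<le> objective f \<psi> v"
  using xstar_min by (simp add: is_arg_min_linorder)

text \<open>Proximal points have finite objective, hence so does a minimizer.\<close>

lemma psi_xstar: "\<psi> xstar \<noteq> \<infinity>"
proof
  assume "\<psi> xstar = \<infinity>"
  then have "\<psi> v = \<infinity>" for v using xstar_le[of v] by (auto simp: objective_def)
  then show False using psi_y_next by blast
qed

lemma objective_gap:
  assumes "\<psi> v \<noteq> \<infinity>"
  shows "objective f \<psi> v - objective f \<psi> xstar = ereal (gap v)"
  using psi_real[OF assms] psi_real[OF psi_xstar] unfolding objective_def gap_def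
  by (metis ereal_minus(1) plus_ereal.simps(1))

lemma gap_nonneg:
  assumes "\<psi> v \<noteq> \<infinity>"
  shows "0 \<le> gap v"
  using xstar_le[of v] psi_real[OF assms] psi_real[OF psi_xstar] unfolding objective_def gap_def
  by (metis diff_ge_0_iff_ge ereal_less_eq(3) plus_ereal.simps(1))

lemma y_next_in_H: "y_next x w S \<in> H"
  by (rule psi_domain[OF psi_y_next])

lemma xstar_in_H: "xstar \<in> H"
  by (rule psi_domain[OF psi_xstar])

lemma x_point_in_H:
  assumes "y \<in> H" "z \<in> H" "w \<in> H"
  shows "x_point \<theta>1 \<theta>2 (y, z, w) \<in> H"
  unfolding x_point_def split by (intro mem_affine_3 affine_affine_range assms) simp

lemma z_next_in_H:
  assumes "x \<in> H" "z \<in> H"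
  shows "z_next x z w S \<in> H"
proof -
  have "z_next x z w S = \<beta> *\<^sub>R z + (1 - \<beta> - \<gamma> / \<eta>) *\<^sub>R x + (\<gamma> / \<eta>) *\<^sub>R y_next x w S"
    by (simp add: z_next_def algebra_simps)
  also have "\<dots> \<in> H"
    by (intro mem_affine_3 affine_affine_range assms y_next_in_H) simp
  finally show ?thesis .
qed

lemma step_eq:
  "step (y, z, w) = (let x = x_point \<theta>1 \<theta>2 (y, z, w) in
     bind_pmf D (\<lambda>S. map_pmf (\<lambda>b. (y_next x w S, z_next x z w S, if b then y else w)) (bernoulli_pmf \<rho>)))"
  by (simp add: asvrcd_step_def y_next_def z_next_def g_next_def map_pmf_def Let_def)

lemma iter_in_H:
  assumes "(y, z, w) \<in> set_pmf (iter k)"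
  shows "y \<in> H \<and> z \<in> H \<and> w \<in> H"
  using assms
proof (induction k arbitrary: y z w)
  case 0
  then show ?case by (simp add: base_in_affine_range)
next
  case (Suc k)
  then obtain y1 z1 w1 where 1: "(y1, z1, w1) \<in> set_pmf (iter k)"
    and 2: "(y, z, w) \<in> set_pmf (step (y1, z1, w1))" by auto
  from Suc.IH[OF 1] 2 show ?case
    by (auto simp: step_eq Let_def y_next_in_H intro!: z_next_in_H x_point_in_H)
qed

text \<open>The expectation of the accelerated step inequality for \<open>u = xstar\<close>. The terms linear in the estimator
  turn into gradients, and strong convexity turns these into differences of function values. In
  the comparison with \<open>xstar\<close> the strong convexity term cancels \<open>1 - \<beta> = \<gamma> \<mu>\<close> times the squared
  distance from \<open>x\<close> to \<open>xstar\<close>. In the comparison with \<open>w\<close> one keeps the exact expression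
  \<open>f w - f x - bregman f w x\<close>; the Bregman distance cancels the variance. What remains
  of \<open>f x\<close> has total coefficient zero.\<close>

lemma expected_step_inequality:
  assumes H: "y \<in> H" "z \<in> H" "w \<in> H" and fin: "\<psi> y \<noteq> \<infinity>" "\<psi> w \<noteq> \<infinity>"
    and x: "x = x_point \<theta>1 \<theta>2 (y, z, w)"
    and var: "E (\<lambda>S. wnorm_sq W (g_next x w S - grad f x)) \<le> 2 * L' * bregman f w x"
  shows "E (\<lambda>S. (norm (z_next x z w S - xstar))\<^sup>2) + 2 * \<gamma> * total_weight * E (\<lambda>S. gap (y_next x w S))
    \<le> \<beta> * (norm (z - xstar))\<^sup>2
      + 2 * \<gamma> * (\<beta> / \<theta>1 * (\<theta>2 * gap w + (1 - \<theta>1 - \<theta>2) * gap y))"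
proof -
  define G where "G = grad f x"
  define \<theta>3 where "\<theta>3 = 1 - \<theta>1 - \<theta>2"
  define k where "k = \<beta> / \<theta>1"
  define V where "V S = wnorm_sq W (g_next x w S - G)" for S
  define pr where "pr v = real_of_ereal (\<psi> v)" for v
  define h where "h = (xstar - x) + k *\<^sub>R (\<theta>2 *\<^sub>R (w - x) + \<theta>3 *\<^sub>R (y - x))"
  define K where "K = \<beta> * (norm (z - xstar))\<^sup>2 + (1 - \<beta>) * (norm (x - xstar))\<^sup>2
     + 2 * \<gamma> * (pr xstar + k * (\<theta>2 * pr w + \<theta>3 * pr y) + total_weight * f x)"
  have xH: "x \<in> H" unfolding x by (rule x_point_in_H[OF H])
  have W: "transpose W = W" "W ** W = W" using W_proj by (auto simp: projection_matrix_def)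
  have xeq: "x = \<theta>1 *\<^sub>R z + \<theta>2 *\<^sub>R w + (1 - \<theta>1 - \<theta>2) *\<^sub>R y" by (simp add: x x_point_def)
  have \<theta>3: "0 \<le> \<theta>3" using theta1_bounds theta2_bounds by (simp add: \<theta>3_def)
  have k0: "0 < k" using beta_bounds theta1_bounds by (simp add: k_def)
  have total_weight_eq: "total_weight = 1 + k * (\<theta>2 + \<theta>3)" using theta1_bounds by (simp add: total_weight_def k_def \<theta>3_def field_simps)
  have int: "integrable (measure_pmf D) X" for X :: "'d set \<Rightarrow> real"
    by (rule integrable_measure_pmf_finite) simp
  have pw: "(norm (z_next x z w S - xstar))\<^sup>2 + 2 * \<gamma> * total_weight * (f (y_next x w S) + pr (y_next x w S))
    \<le> K + 2 * \<gamma> * (g_next x w S \<bullet> h) + \<gamma> * total_weight * noise_weight * V S" for S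
  proof -
    let ?g = "g_next x w S" and ?y = "y_next x w S"
    have "(norm (z_next x z w S - xstar))\<^sup>2 + 2 * \<gamma> * total_weight * (f ?y + pr ?y)
      \<le> \<beta> * (norm (z - xstar))\<^sup>2 + (1 - \<beta>) * (norm (x - xstar))\<^sup>2
        + 2 * \<gamma> * (pr xstar + ?g \<bullet> (xstar - x) + \<beta> / \<theta>1 * (\<theta>2 * (pr w + ?g \<bullet> (w - x))
                 + (1 - \<theta>1 - \<theta>2) * (pr y + ?g \<bullet> (y - x))) + total_weight * f x)
        + \<gamma> * total_weight * noise_weight * (norm (W *v (?g - G)))\<^sup>2"
    proof (rule accelerated_step_inequality[where L = L and x = x and y' = ?y and g = ?g and G = G and \<eta> = \<eta>])
      show "\<theta>1 + \<theta>2 \<le> 1" using \<theta>3 by (simp add: \<theta>3_def)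
      show "x = \<theta>1 *\<^sub>R z + \<theta>2 *\<^sub>R w + (1 - \<theta>1 - \<theta>2) *\<^sub>R y" by (rule xeq)
      show "pr ?y + ((x - \<eta> *\<^sub>R ?g - ?y) \<bullet> (v - ?y)) / \<eta> \<le> q"
        if "(v, q) \<in> {(xstar, pr xstar), (w, pr w), (y, pr y)}" for v q
      proof -
        have "\<psi> v = ereal q" using that psi_real psi_xstar fin by (auto simp: pr_def)
        then show ?thesis
          unfolding y_next_def pr_def
          by (rule prox_variational_inequality[OF psi_convex prox_wd eta_pos])
             (rule psi_real[OF psi_y_next[unfolded y_next_def]])
      qed
      show "f ?y \<le> f x + G \<bullet> (?y - x) + L / 2 * (norm (?y - x))\<^sup>2"
        unfolding G_def by (rule smooth[OF y_next_in_H xH])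
      show "(?g - G) \<bullet> (?y - x) = (W *v (?g - G)) \<bullet> (?y - x)"
      proof -
        obtain r where "?y - x = W *v r" using diff_affine_range[OF y_next_in_H xH] by blast
        then have "W *v (?y - x) = ?y - x" by (simp add: matrix_vector_mul_assoc W)
        then show ?thesis by (simp add: dot_matrix_vector_symmetric[OF W(1)])
      qed
    qed (use eta_pos beta_bounds gamma_pos theta1_bounds theta2_bounds noise_weight_pos total_weight_def step_length_condition
         in \<open>auto simp: z_next_def\<close>)
    also have "(norm (W *v (?g - G)))\<^sup>2 = V S"
      by (simp add: V_def wnorm_sq_def power2_norm_eq_inner dot_matrix_vector_symmetric[OF W(1)]
          matrix_vector_mul_assoc W(2) inner_commute)
    also have "2 * \<gamma> * (pr xstar + ?g \<bullet> (xstar - x) + \<beta> / \<theta>1 * (\<theta>2 * (pr w + ?g \<bullet> (w - x))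
                 + (1 - \<theta>1 - \<theta>2) * (pr y + ?g \<bullet> (y - x))) + total_weight * f x)
        = 2 * \<gamma> * (pr xstar + k * (\<theta>2 * pr w + \<theta>3 * pr y) + total_weight * f x) + 2 * \<gamma> * (?g \<bullet> h)"
    proof -
      have "?g \<bullet> h = ?g \<bullet> (xstar - x) + k * (\<theta>2 * (?g \<bullet> (w - x)) + \<theta>3 * (?g \<bullet> (y - x)))"
        by (simp only: h_def inner_add_right inner_scaleR_right)
      then show ?thesis
        unfolding k_def[symmetric] \<theta>3_def[symmetric] by (simp only: ring_distribs)
    qed
    finally show ?thesis by (simp add: K_def)
  qed
  have "E (\<lambda>S. (norm (z_next x z w S - xstar))\<^sup>2 + 2 * \<gamma> * total_weight * (f (y_next x w S) + pr (y_next x w S)))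
      \<le> E (\<lambda>S. K + 2 * \<gamma> * (g_next x w S \<bullet> h) + \<gamma> * total_weight * noise_weight * V S)"
    by (intro integral_mono int pw)
  also have "\<dots> = K + 2 * \<gamma> * (G \<bullet> h) + \<gamma> * total_weight * noise_weight * E V"
    using expectation_grad_estimator[OF p_pos, of f x w h]
    by (simp add: int G_def g_next_def)
  also have "\<dots> \<le> K + 2 * \<gamma> * (G \<bullet> h) + 2 * \<gamma> * (k * \<theta>2 * bregman f w x)"
  proof -
    have "\<gamma> * total_weight * noise_weight * E V \<le> \<gamma> * (total_weight * noise_weight) * (2 * L' * bregman f w x)"
      using var gamma_pos total_weight_ge noise_weight_pos by (simp add: V_def[abs_def] G_def mult.assoc)
    also have "\<dots> = 2 * \<gamma> * (k * \<theta>2 * bregman f w x)"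
      unfolding total_weight_times_noise_weight using L'_pos by (simp add: k_def)
    finally show ?thesis by simp
  qed
  finally have 1: "E (\<lambda>S. (norm (z_next x z w S - xstar))\<^sup>2)
      + 2 * \<gamma> * total_weight * E (\<lambda>S. f (y_next x w S) + pr (y_next x w S))
      \<le> K + 2 * \<gamma> * (G \<bullet> h + k * \<theta>2 * bregman f w x)"
    by (simp add: int algebra_simps)
  have "G \<bullet> (xstar - x) \<le> f xstar - f x - \<mu> / 2 * (norm (x - xstar))\<^sup>2"
    using strong xstar_in_H xH unfolding strongly_convex_over_def G_def
    by (force simp: norm_minus_commute)
  moreover have "k * (\<theta>3 * (G \<bullet> (y - x))) \<le> k * (\<theta>3 * (f y - f x))"
  proof -
    have "f y \<ge> f x + G \<bullet> (y - x) + \<mu> / 2 * (norm (y - x))\<^sup>2"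
      using strong H xH unfolding strongly_convex_over_def G_def by blast
    moreover have "0 \<le> \<mu> / 2 * (norm (y - x))\<^sup>2" using mu_pos by simp
    ultimately show ?thesis using k0 \<theta>3 by (intro mult_left_mono) auto
  qed
  moreover have "G \<bullet> h + k * \<theta>2 * bregman f w x
     = G \<bullet> (xstar - x) + k * (\<theta>3 * (G \<bullet> (y - x))) + k * \<theta>2 * (f w - f x)"
    by (simp add: h_def bregman_def G_def inner_add_right algebra_simps)
  ultimately have "G \<bullet> h + k * \<theta>2 * bregman f w x
     \<le> f xstar - f x - \<mu> / 2 * (norm (x - xstar))\<^sup>2 + k * (\<theta>3 * (f y - f x)) + k * \<theta>2 * (f w - f x)"
    by linarith
  from mult_left_mono[OF this, of "2 * \<gamma>"] gamma_pos 1
  have 2: "E (\<lambda>S. (norm (z_next x z w S - xstar))\<^sup>2)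
      + 2 * \<gamma> * total_weight * E (\<lambda>S. f (y_next x w S) + pr (y_next x w S))
    \<le> K + 2 * \<gamma> * (f xstar - f x - \<mu> / 2 * (norm (x - xstar))\<^sup>2 + k * (\<theta>3 * (f y - f x)) + k * \<theta>2 * (f w - f x))"
    by linarith
  also have "\<dots> = \<beta> * (norm (z - xstar))\<^sup>2 + 2 * \<gamma> * (k * (\<theta>2 * gap w + \<theta>3 * gap y))
      + 2 * \<gamma> * total_weight * (f xstar + pr xstar)"
  proof -
    have b: "1 - \<beta> = \<gamma> * \<mu>" by (simp add: beta_eq)
    show ?thesis unfolding K_def gap_def pr_def[symmetric] total_weight_eq b by (simp add: algebra_simps)
  qed
  finally have 3: "E (\<lambda>S. (norm (z_next x z w S - xstar))\<^sup>2)
      + 2 * \<gamma> * total_weight * E (\<lambda>S. f (y_next x w S) + pr (y_next x w S))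
    \<le> \<beta> * (norm (z - xstar))\<^sup>2 + 2 * \<gamma> * (k * (\<theta>2 * gap w + \<theta>3 * gap y))
      + 2 * \<gamma> * total_weight * (f xstar + pr xstar)" .
  have "E (\<lambda>S. gap (y_next x w S)) = E (\<lambda>S. f (y_next x w S) + pr (y_next x w S)) - (f xstar + pr xstar)"
    unfolding gap_def pr_def[symmetric] by (simp add: int)
  with 3 show ?thesis unfolding k_def[symmetric] \<theta>3_def[symmetric] by (simp add: right_diff_distrib)
qed

lemma weights_pos: "0 < 2 * \<gamma> * \<beta> / \<theta>1" "0 < (2 * \<theta>2 + \<theta>1) * \<gamma> * \<beta> / (\<theta>1 * \<rho>)"
  using gamma_pos beta_bounds theta1_bounds theta2_bounds rho
  by (auto intro!: divide_pos_pos mult_pos_pos add_pos_pos)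

lemma potential_finite:
  assumes "\<psi> y \<noteq> \<infinity>" "\<psi> w \<noteq> \<infinity>"
  shows "\<Psi> (y, z, w) = ereal ((norm (z - xstar))\<^sup>2 + 2 * \<gamma> * \<beta> / \<theta>1 * gap y
    + (2 * \<theta>2 + \<theta>1) * \<gamma> * \<beta> / (\<theta>1 * \<rho>) * gap w)"
  by (simp add: potential_def objective_gap assms)

lemma objective_diff_infinite: "\<psi> v = \<infinity> \<Longrightarrow> objective f \<psi> v - objective f \<psi> xstar = \<infinity>"
  by (subst (2) objective_def, subst psi_real[OF psi_xstar]) (simp add: objective_def)

lemma objective_diff_nonneg: "0 \<le> objective f \<psi> v - objective f \<psi> xstar"
  by (cases "\<psi> v = \<infinity>") (auto simp: objective_diff_infinite objective_gap gap_nonneg)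

lemma potential_nonneg: "0 \<le> \<Psi> s"
  unfolding potential_def using weights_pos objective_diff_nonneg
  by (auto split: prod.split intro!: add_nonneg_nonneg ereal_0_le_mult)

lemma potential_infinite:
  assumes "\<psi> y = \<infinity> \<or> \<psi> w = \<infinity>"
  shows "\<Psi> (y, z, w) = \<infinity>"
proof -
  let ?A = "2 * \<gamma> * \<beta> / \<theta>1" and ?C = "(2 * \<theta>2 + \<theta>1) * \<gamma> * \<beta> / (\<theta>1 * \<rho>)"
  have nn: "0 \<le> ereal ?A * (objective f \<psi> y - objective f \<psi> xstar)"
    "0 \<le> ereal ?C * (objective f \<psi> w - objective f \<psi> xstar)"
    using weights_pos objective_diff_nonneg by (auto intro!: ereal_0_le_mult)
  have "ereal ?A * (objective f \<psi> y - objective f \<psi> xstar) = \<infinity>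
      \<or> ereal ?C * (objective f \<psi> w - objective f \<psi> xstar) = \<infinity>"
    using assms weights_pos by (auto simp: objective_diff_infinite)
  then show ?thesis unfolding potential_def split using nn by (auto simp: ereal_plus_eq_PInfty)
qed

text \<open>If \<open>\<psi>\<close> is infinite at \<open>y\<close> or \<open>w\<close>, the potential on the right is infinite and there is nothing to
  show. Otherwise all quantities are real. The next reference point is \<open>y\<close> with probability
  \<open>\<rho>\<close> and \<open>w\<close> with probability \<open>1 - \<rho>\<close>, so that its expected gap \<open>B\<close> does not depend on the
  sampled set.\<close>

lemma expected_potential_decreases:
  assumes H: "y \<in> H" "z \<in> H" "w \<in> H" and x: "x = x_point \<theta>1 \<theta>2 (y, z, w)"
    and var: "E (\<lambda>S. wnorm_sq W (grad_estimator f D x w S - grad f x)) \<le> 2 * L' * bregman f w x"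
  shows "ext_expectation (step (y, z, w)) \<Psi> \<le> ereal (1 - rate) * \<Psi> (y, z, w)"
proof (cases "\<psi> y = \<infinity> \<or> \<psi> w = \<infinity>")
  case True
  then show ?thesis using potential_infinite rate_le_quarter by simp
next
  case False
  then have fin: "\<psi> y \<noteq> \<infinity>" "\<psi> w \<noteq> \<infinity>" by auto
  define A where "A = 2 * \<gamma> * \<beta> / \<theta>1"
  define C where "C = (2 * \<theta>2 + \<theta>1) * \<gamma> * \<beta> / (\<theta>1 * \<rho>)"
  have AC: "0 < A" "0 < C" using weights_pos by (simp_all only: A_def C_def)
  note contract = potential_weights_contract[folded A_def C_def]
  have pot: "\<Psi> (u, v, r) = ereal ((norm (v - xstar))\<^sup>2 + A * gap u + C * gap r)"
    if "\<psi> u \<noteq> \<infinity>" "\<psi> r \<noteq> \<infinity>" for u v r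
    unfolding A_def C_def by (rule potential_finite[OF that])
  define Z where "Z S = (norm (z_next x z w S - xstar))\<^sup>2" for S
  define Y where "Y S = gap (y_next x w S)" for S
  define B where "B = \<rho> * gap y + (1 - \<rho>) * gap w"
  have int: "integrable (measure_pmf D) X" for X :: "'d set \<Rightarrow> real"
    by (rule integrable_measure_pmf_finite) simp
  have nn: "0 \<le> Z S" "0 \<le> A * Y S" "0 \<le> C * gap y" "0 \<le> C * gap w" "0 \<le> C * B" for S
    using AC gap_nonneg fin psi_y_next rho by (auto simp: Z_def Y_def B_def)
  have "(\<integral>\<^sup>+ s. e2ennreal (\<Psi> s) \<partial>measure_pmf (step (y, z, w)))
      = (\<integral>\<^sup>+ S. ennreal (Z S + A * Y S + C * B) \<partial>measure_pmf D)"
  proof -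
    have "(\<integral>\<^sup>+ b. e2ennreal (\<Psi> (y_next x w S, z_next x z w S, if b then y else w)) \<partial>bernoulli_pmf \<rho>)
        = ennreal (Z S + A * Y S + C * B)" for S
    proof -
      have "(\<integral>\<^sup>+ b. e2ennreal (\<Psi> (y_next x w S, z_next x z w S, if b then y else w)) \<partial>bernoulli_pmf \<rho>)
          = ennreal (Z S + A * Y S + C * gap y) * ennreal \<rho>
            + ennreal (Z S + A * Y S + C * gap w) * ennreal (1 - \<rho>)"
        using rho by (simp add: nn_integral_bernoulli_pmf pot psi_y_next fin Z_def Y_def)
      also have "\<dots> = ennreal ((Z S + A * Y S + C * gap y) * \<rho> + (Z S + A * Y S + C * gap w) * (1 - \<rho>))"
        using nn rho by (simp add: ennreal_mult ennreal_plus)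
      also have "(Z S + A * Y S + C * gap y) * \<rho> + (Z S + A * Y S + C * gap w) * (1 - \<rho>)
          = Z S + A * Y S + C * B"
        unfolding B_def by (simp only: ring_distribs) (simp add: algebra_simps)
      finally show ?thesis .
    qed
    then show ?thesis by (simp add: step_eq Let_def flip: x)
  qed
  also have "\<dots> = ennreal (E (\<lambda>S. Z S + A * Y S + C * B))"
    by (intro nn_integral_eq_integral int AE_I2 add_nonneg_nonneg nn)
  also have "E (\<lambda>S. Z S + A * Y S + C * B) = E Z + A * E Y + C * B"
    by (simp add: int)
  also have "ennreal (E Z + A * E Y + C * B)
      \<le> ennreal ((1 - rate) * ((norm (z - xstar))\<^sup>2 + A * gap y + C * gap w))"
  proof (rule ennreal_leI)
    have "A * E Y \<le> 2 * \<gamma> * total_weight * E Y"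
    proof (rule mult_right_mono)
      show "0 \<le> E Y" by (intro integral_nonneg_AE AE_I2) (auto simp: Y_def gap_nonneg psi_y_next)
      show "A \<le> 2 * \<gamma> * total_weight" using mult_left_mono[OF total_weight_ge(1), of "2 * \<gamma>"] gamma_pos by (simp add: A_def)
    qed
    moreover have "E Z + 2 * \<gamma> * total_weight * E Y \<le> \<beta> * (norm (z - xstar))\<^sup>2
      + 2 * \<gamma> * (\<beta> / \<theta>1 * (\<theta>2 * gap w + (1 - \<theta>1 - \<theta>2) * gap y))"
      unfolding Z_def Y_def by (rule expected_step_inequality[OF H fin x]) (use var in \<open>simp add: g_next_def\<close>)
    moreover have "2 * \<gamma> * (\<beta> / \<theta>1 * (\<theta>2 * gap w + (1 - \<theta>1 - \<theta>2) * gap y)) + C * B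
        = (A * (1 - \<theta>1 - \<theta>2) + C * \<rho>) * gap y + (A * \<theta>2 + C * (1 - \<rho>)) * gap w"
    proof -
      have "2 * \<gamma> * (\<beta> / \<theta>1 * X) = A * X" for X by (simp add: A_def)
      then show ?thesis unfolding B_def by (simp only: ring_distribs mult.assoc)
    qed
    ultimately have "E Z + A * E Y + C * B \<le> \<beta> * (norm (z - xstar))\<^sup>2
        + (A * (1 - \<theta>1 - \<theta>2) + C * \<rho>) * gap y + (A * \<theta>2 + C * (1 - \<rho>)) * gap w"
      by linarith
    also have "\<dots> \<le> (1 - rate) * (norm (z - xstar))\<^sup>2
        + ((1 - rate) * A) * gap y + ((1 - rate) * C) * gap w"
      using contract gap_nonneg fin by (intro add_mono mult_right_mono) auto
    also have "\<dots> = (1 - rate) * ((norm (z - xstar))\<^sup>2 + A * gap y + C * gap w)"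
      by (simp only: ring_distribs mult.assoc)
    finally show "E Z + A * E Y + C * B \<le> (1 - rate) * ((norm (z - xstar))\<^sup>2 + A * gap y + C * gap w)" .
  qed
  finally have le: "(\<integral>\<^sup>+ s. e2ennreal (\<Psi> s) \<partial>measure_pmf (step (y, z, w)))
      \<le> ennreal ((1 - rate) * ((norm (z - xstar))\<^sup>2 + A * gap y + C * gap w))" .
  have "0 \<le> (1 - rate) * ((norm (z - xstar))\<^sup>2 + A * gap y + C * gap w)"
    using nn rate_le_quarter AC gap_nonneg fin by (intro mult_nonneg_nonneg add_nonneg_nonneg) auto
  then have "ext_expectation (step (y, z, w)) \<Psi>
      \<le> ereal ((1 - rate) * ((norm (z - xstar))\<^sup>2 + A * gap y + C * gap w))"
    using le unfolding ext_expectation_def by (metis enn2ereal_ennreal less_eq_ennreal.rep_eq)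
  then show ?thesis by (simp add: pot[OF fin])
qed

end


section \<open>Iteration complexity\<close>

lemma e2ennreal_mult_real:
  assumes "0 \<le> q"
  shows "e2ennreal (ereal q * x) = ennreal q * e2ennreal x"
proof (cases x)
  case (real r)
  then show ?thesis using assms by (simp add: ennreal_mult')
next
  case PInf
  then show ?thesis using assms by (cases "q = 0") (auto simp: ennreal_mult_top)
next
  case MInf
  then show ?thesis using assms by (cases "q = 0") (auto simp: e2ennreal_neg)
qed

lemma ext_expectation_return:
  "0 \<le> X s \<Longrightarrow> ext_expectation (return_pmf s) X = X s"
  by (simp add: ext_expectation_def enn2ereal_e2ennreal)

lemma ext_expectation_bind_le:
  assumes q: "0 \<le> q" and le: "\<And>s. s \<in> set_pmf p \<Longrightarrow> ext_expectation (K s) X \<le> ereal q * X s"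
  shows "ext_expectation (bind_pmf p K) X \<le> ereal q * ext_expectation p X"
proof -
  have "(\<integral>\<^sup>+ t. e2ennreal (X t) \<partial>K s) \<le> ennreal q * e2ennreal (X s)" if "s \<in> set_pmf p" for s
    using e2ennreal_mono[OF le[OF that]] q
    by (simp add: ext_expectation_def e2ennreal_mult_real)
  then have "(\<integral>\<^sup>+ t. e2ennreal (X t) \<partial>bind_pmf p K) \<le> (\<integral>\<^sup>+ s. ennreal q * e2ennreal (X s) \<partial>p)"
    by (simp add: nn_integral_mono_AE AE_measure_pmf_iff)
  also have "\<dots> = ennreal q * (\<integral>\<^sup>+ s. e2ennreal (X s) \<partial>p)"
    by (rule nn_integral_cmult) simp
  finally show ?thesis
    using q by (simp add: ext_expectation_def less_eq_ennreal.rep_eq times_ennreal.rep_eq enn2ereal_ennreal)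
qed

text \<open>Linear convergence with factor \<open>1 - r\<close> reaches relative accuracy \<open>\<epsilon>\<close> after \<open>ln (1 / \<epsilon>) / r\<close> steps,
  because \<open>1 - r \<le> exp (- r)\<close>.\<close>

lemma power_one_minus_le:
  fixes r \<epsilon> K :: real
  assumes r: "0 < r" "r \<le> 1" and \<epsilon>: "0 < \<epsilon>" "\<epsilon> < 1" and K: "1 \<le> K * r" and k: "K * ln (1 / \<epsilon>) \<le> real k"
  shows "(1 - r) ^ k \<le> \<epsilon>"
proof -
  have ln: "0 < ln (1 / \<epsilon>)" using \<epsilon> by simp
  have "1 * ln (1 / \<epsilon>) \<le> (K * r) * ln (1 / \<epsilon>)" using K ln by (intro mult_right_mono) auto
  also have "\<dots> = r * (K * ln (1 / \<epsilon>))" by simp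
  also have "\<dots> \<le> r * real k" using k r by (intro mult_left_mono) auto
  finally have e: "- (r * real k) \<le> ln \<epsilon>" using \<epsilon> by (simp add: ln_div)
  have "(1 - r) ^ k \<le> exp (- r) ^ k"
    using r exp_ge_add_one_self[of "- r"] by (intro power_mono) auto
  also have "\<dots> = exp (- (r * real k))" by (simp add: exp_of_nat_mult[symmetric] mult.commute)
  also have "\<dots> \<le> \<epsilon>" using e \<epsilon> by (metis exp_le_cancel_iff exp_ln)
  finally show ?thesis .
qed

context asvrcd_problem
begin

context
  assumes variance_bound: "\<And>k y z w x. (y, z, w) \<in> set_pmf (iter k) \<Longrightarrow> x = x_point \<theta>1 \<theta>2 (y, z, w) \<Longrightarrow>
    E (\<lambda>S. wnorm_sq W (grad_estimator f D x w S - grad f x)) \<le> 2 * L' * bregman f w x"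
begin

lemma step_contracts_on_iterates:
  assumes "s \<in> set_pmf (iter k)"
  shows "ext_expectation (step s) \<Psi> \<le> ereal (1 - rate) * \<Psi> s"
proof -
  obtain y z w where s: "s = (y, z, w)" by (cases s)
  then have mem: "(y, z, w) \<in> set_pmf (iter k)" using assms by simp
  show ?thesis unfolding s
    using expected_potential_decreases[OF _ _ _ refl variance_bound[OF mem refl]] iter_in_H[OF mem]
    by blast
qed

lemma expected_potential_geometric:
  "ext_expectation (iter k) \<Psi> \<le> ereal ((1 - rate) ^ k) * \<Psi> (x0, x0, x0)"
proof (induction k)
  case 0
  then show ?case by (simp add: ext_expectation_return potential_nonneg one_ereal_def[symmetric])
next
  case (Suc k)
  have r: "0 \<le> 1 - rate" using rate_le_quarter by linarith
  have "ext_expectation (iter (Suc k)) \<Psi> \<le> ereal (1 - rate) * ext_expectation (iter k) \<Psi>"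
    unfolding asvrcd.simps by (intro ext_expectation_bind_le r step_contracts_on_iterates)
  also have "\<dots> \<le> ereal (1 - rate) * (ereal ((1 - rate) ^ k) * \<Psi> (x0, x0, x0))"
    by (intro ereal_mult_left_mono Suc.IH) (use r in simp)
  also have "\<dots> = ereal ((1 - rate) ^ Suc k) * \<Psi> (x0, x0, x0)"
    unfolding mult.assoc[symmetric] times_ereal.simps power_Suc ..
  finally show ?case .
qed

lemma asvrcd_iteration_complexity:
  "iteration_complexity 8 (1 / \<rho> + sqrt (L / \<mu>) + sqrt (L' / (\<rho> * \<mu>)))
     (\<lambda>k. ext_expectation (iter k) \<Psi>) (\<Psi> (x0, x0, x0))"
  unfolding iteration_complexity_def
proof (intro ballI allI impI)
  fix \<epsilon> :: real and k
  let ?K = "1 / \<rho> + sqrt (L / \<mu>) + sqrt (L' / (\<rho> * \<mu>))"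
  assume \<epsilon>: "\<epsilon> \<in> {0<..<1}" and k: "8 * ?K * ln (1 / \<epsilon>) \<le> real k"
  have "(1 - rate) ^ k \<le> \<epsilon>"
  proof (rule power_one_minus_le[OF _ _ _ _ _ k])
    show "rate \<le> 1" using rate_le_quarter by linarith
    show "1 \<le> 8 * ?K * rate" by (rule complexity_bound[OF refl refl])
  qed (use rate_pos \<epsilon> in auto)
  then have "ereal ((1 - rate) ^ k) * \<Psi> (x0, x0, x0) \<le> ereal \<epsilon> * \<Psi> (x0, x0, x0)"
    by (intro ereal_mult_right_mono potential_nonneg) simp
  with expected_potential_geometric[of k]
  show "ext_expectation (iter k) \<Psi> \<le> ereal \<epsilon> * \<Psi> (x0, x0, x0)" by (rule order_trans)
qed

end

end

theorem theorem4p1: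
  fixes f :: "real^'d \<Rightarrow> real"
    and \<psi> \<psi>' :: "real^'d \<Rightarrow> ereal"
    and M W :: "real^'d^'d"
    and x0 xstar :: "real^'d"
    and D :: "'d::finite set pmf"
    and \<mu> L L' \<theta>1 \<theta>2 \<eta> \<beta> \<gamma> \<rho> :: real
  defines "P \<equiv> objective f \<psi>"
    and "step \<equiv> asvrcd_step f \<psi> D \<theta>1 \<theta>2 \<eta> \<beta> \<gamma> \<rho>"
    and "iter \<equiv> asvrcd f \<psi> D \<theta>1 \<theta>2 \<eta> \<beta> \<gamma> \<rho> x0"
    and "\<Psi> \<equiv> potential f \<psi> \<theta>1 \<theta>2 \<beta> \<gamma> \<rho> xstar"
  assumes f_convex: "convex_on UNIV f"
    and f_diff: "f differentiable_on UNIV"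
    and psi_convex: "ext_convex \<psi>"
    and xstar_min: "is_arg_min P (\<lambda>_. True) xstar"
    and W_proj: "projection_matrix W"
    and psi'_convex: "ext_convex \<psi>'"
    and psi_on: "\<And>x. x \<in> affine_range x0 W \<Longrightarrow> \<psi> x = \<psi>' x"
    and psi_off: "\<And>x. x \<notin> affine_range x0 W \<Longrightarrow> \<psi> x = \<infinity>"
    and M_psd: "psd M"
    and f_smooth: "matrix_smooth f M"
    and mu_pos: "\<mu> > 0"
    and f_strong: "strongly_convex_over (affine_range x0 W) \<mu> f"
    and L_eq: "L = lambda_max (psd_sqrt M ** W ** psd_sqrt M)"
    and L'_pos: "L' > 0"
    and rho: "0 < \<rho>" "\<rho> < 1"
    and p_pos: "\<And>i. incl_prob D i > 0"
    and eta_eq: "\<eta> = 1/4 * inverse (max L' L)"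
    and theta2_eq: "\<theta>2 = L' / (2 * max L L')"
    and gamma_eq: "\<gamma> = 1 / max (2 * \<mu>) (4 * \<theta>1 / \<eta>)"
    and beta_eq: "\<beta> = 1 - \<gamma> * \<mu>"
    and theta1_eq: "\<theta>1 = min (1/2) (sqrt (\<eta> * \<mu> * max (1/2) (\<theta>2 / \<rho>)))"
    and prox_wd: "prox_well_defined \<eta> \<psi>"
    and variance_bound: "\<And>k y z w x. (y, z, w) \<in> set_pmf (iter k) \<Longrightarrow>
          x = x_point \<theta>1 \<theta>2 (y, z, w) \<Longrightarrow>
          measure_pmf.expectation D (\<lambda>S. wnorm_sq W (grad_estimator f D x w S - grad f x))
            \<le> 2 * L' * bregman f w x"
  shows "(\<forall>k. \<forall>s\<in>set_pmf (iter k).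
            ext_expectation (step s) \<Psi>
              \<le> ereal (1 - 1/4 * min \<rho> (sqrt (\<mu> / (2 * max L (L' / \<rho>))))) * \<Psi> s) \<and>
         iteration_complexity 8 (1 / \<rho> + sqrt (L / \<mu>) + sqrt (L' / (\<rho> * \<mu>)))
           (\<lambda>k. ext_expectation (iter k) \<Psi>) (\<Psi> (x0, x0, x0))"
proof -
  have smooth: "f u \<le> f v + grad f v \<bullet> (u - v) + L / 2 * (norm (u - v))\<^sup>2"
    if "u \<in> affine_range x0 W" "v \<in> affine_range x0 W" for u v
  proof -
    have "f u \<le> f v + grad f v \<bullet> (u - v) + 1/2 * wnorm_sq M (u - v)"
      using f_smooth by (simp add: matrix_smooth_def)
    moreover have "wnorm_sq M (u - v) \<le> L * (norm (u - v))\<^sup>2"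
      by (rule wnorm_sq_le_on_range[OF M_psd W_proj L_eq diff_affine_range[OF that]])
    ultimately show ?thesis by simp
  qed
  interpret asvrcd_problem \<mu> L L' \<theta>1 \<theta>2 \<eta> \<beta> \<gamma> \<rho> f \<psi> D W x0 xstar
  proof unfold_locales
    show "0 \<le> L" by (rule lambda_max_nonneg[OF M_psd W_proj L_eq])
    show "v \<in> affine_range x0 W" if "\<psi> v \<noteq> \<infinity>" for v using psi_off that by blast
    show "is_arg_min (objective f \<psi>) (\<lambda>_. True) xstar" using xstar_min by (simp add: P_def)
  qed (fact mu_pos L'_pos rho eta_eq theta2_eq gamma_eq beta_eq theta1_eq psi_convex W_proj smooth
      f_strong p_pos prox_wd)+
  show ?thesis
    unfolding step_def iter_def \<Psi>_def
    using step_contracts_on_iterates asvrcd_iteration_complexity variance_bound[unfolded iter_def]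
    by blast
qed

end
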